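(* Let $m\in\mathbb Z_{\ge1}$ and let $\vec\mu=(\mu_0,\ldots,\mu_{m-1})$ be an $m$-tuple of finite positive measures on $\mathbb T$, where $\mu_{m-1}$ is non-vanishing. (i) If $m=1$, then $\vec\mu$ is allowable. (ii) If $m\ge2$, and there is a constant $c_0$ such that $|\hat f(0)|^2\le c_0\,\mathcal D_{\mu_0,0}(f)$ for all $f\in\mathcal D_a$, then $\vec\mu$ is allowable.
   Context: $\mathbb D$ is the open unit disc, $\mathbb T$ the unit circle. For a finite positive Borel measure $\mu$ on $\mathbb T$, $P_\mu(z)=\int_{\mathbb T}\frac{1-|z|^2}{|\zeta-z|^2}\,d\mu(\zeta)$ is its Poisson extension. $\mathcal D_a$ is the space of functions analytic on $\mathbb D$ and smooth on $\overline{\mathbb D}$, $f(z)=\sum_{k\ge0}\hat f(k)z^k$, and $(M_zf)(z)=zf(z)$. For $f\in\mathcal D_a$ and $n\ge1$, $\mathcal D_{\mu,n}(f)=\lim_{r\to1^-}\frac1{n!(n-1)!\pi}\int_{r\mathbb D}|f^{(n)}(z)|^2P_\mu(z)(1-|z|^2)^{n-1}\,dA(z)$ ($dA$ area measure), and $\mathcal D_{\mu,0}(f)=\int_{\mathbb T}|f|^2\,d\mu$. Put $\|f\|_{\vec\mu}^2=\sum_{n=0}^{m-1}\mathcal D_{\mu_n,n}(f)$. The tuple $\vec\mu$ is allowable if there is $C>0$ with $0\le\|M_zf\|_{\vec\mu}^2\le C^2\|f\|_{\vec\mu}^2$ for all $f\in\mathcal D_a$. *)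

theory Defs
  imports "HOL-Complex_Analysis.Complex_Analysis"
begin

definition finite_circle_measure :: "complex measure \<Rightarrow> bool" where
  "finite_circle_measure \<mu> \<longleftrightarrow>
     finite_measure \<mu> \<and> sets \<mu> = sets (restrict_space borel (sphere 0 1))"

text \<open>Smoothness up to the boundary means that every complex derivative on the open disc extends
  continuously to the closed disc. The first conjunct says that the boundary values of \<open>f\<close> are
  those of its continuous extension; values of \<open>f\<close> outside the closed disc are immaterial.\<close>
definition D_a :: "(complex \<Rightarrow> complex) set" where
  "D_a = {f. continuous_on (cball 0 1) f \<and> f holomorphic_on ball 0 1 \<and>
     (\<forall>n. \<exists>g. continuous_on (cball 0 1) g \<and> (\<forall>z\<in>ball 0 1. g z = (deriv ^^ n) f z))}"

definition taylor_coeff :: "(complex \<Rightarrow> complex) \<Rightarrow> nat \<Rightarrow> complex" where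
  "taylor_coeff f k = fps_nth (fps_expansion f 0) k"

lemma taylor_coeff_sums:
  assumes "f \<in> D_a" "z \<in> ball 0 1"
  shows "(\<lambda>k. taylor_coeff f k * z ^ k) sums f z"
  using holomorphic_power_series[of f 0 1 z] assms
  by (simp add: D_a_def taylor_coeff_def fps_expansion_def)

definition M_z :: "(complex \<Rightarrow> complex) \<Rightarrow> complex \<Rightarrow> complex" where
  "M_z f = (\<lambda>z. z * f z)"

definition poisson_ext :: "complex measure \<Rightarrow> complex \<Rightarrow> real" where
  "poisson_ext \<mu> z = (LINT \<zeta>|\<mu>. (1 - (cmod z)\<^sup>2) / (cmod (\<zeta> - z))\<^sup>2)"

text \<open>For \<open>n \<ge> 1\<close> and \<open>f \<in> D_a\<close> the integral below is nondecreasing and bounded in \<open>r < 1\<close>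
  (\<open>f\<^sup>(\<^sup>n\<^sup>)\<close> is bounded and \<open>P\<^sub>\<mu>\<close> is area-integrable on the disc), so the limit exists and is finite.\<close>
definition dirichlet_int :: "complex measure \<Rightarrow> nat \<Rightarrow> (complex \<Rightarrow> complex) \<Rightarrow> real" where
  "dirichlet_int \<mu> n f =
     (if n = 0 then (LINT \<zeta>|\<mu>. (cmod (f \<zeta>))\<^sup>2)
      else Lim (at_left 1) (\<lambda>r::real. 1 / (fact n * fact (n - 1) * pi) *
        (LINT z:ball 0 r|lborel.
           (cmod ((deriv ^^ n) f z))\<^sup>2 * poisson_ext \<mu> z * (1 - (cmod z)\<^sup>2) ^ (n - 1))))"

text \<open>An \<open>m\<close>-tuple \<open>(\<mu>\<^sub>0, \<dots>, \<mu>\<^bsub>m-1\<^esub>)\<close> is encoded as a function on \<open>nat\<close> of which only the values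
  below \<open>m\<close> are used.\<close>
definition norm_sq :: "nat \<Rightarrow> (nat \<Rightarrow> complex measure) \<Rightarrow> (complex \<Rightarrow> complex) \<Rightarrow> real" where
  "norm_sq m \<mu> f = (\<Sum>n<m. dirichlet_int (\<mu> n) n f)"

definition allowable :: "nat \<Rightarrow> (nat \<Rightarrow> complex measure) \<Rightarrow> bool" where
  "allowable m \<mu> \<longleftrightarrow>
     (\<exists>C>0. \<forall>f\<in>D_a. 0 \<le> norm_sq m \<mu> (M_z f) \<and> norm_sq m \<mu> (M_z f) \<le> C\<^sup>2 * norm_sq m \<mu> f)"

end

theory Submission imports Defs begin

text \<open>
  On the boundary, multiplication by \<open>z\<close> is isometric, which settles \<open>m = 1\<close> and the term of order
  \<open>0\<close> in general. For a term of order \<open>n \<ge> 1\<close> one has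
  \<open>(z f)\<^bsup>(n)\<^esup> = z f\<^bsup>(n)\<^esup> + n f\<^bsup>(n-1)\<^esup>\<close>, so the question is how to control the weighted square integral
  of \<open>h = f\<^bsup>(n-1)\<^esup>\<close> by that of \<open>h'\<close>, for the weight \<open>P\<^sub>\<mu>(z) (1 - \<bar>z\<bar>\<^sup>2)\<^bsup>n-1\<^esup>\<close>. The heart of the proof is
  the weighted Poincare inequality \<open>point_energy_poincare\<close>: up to absolute constants, the integral of
  \<open>\<bar>h\<bar>\<^sup>2\<close> is at most \<open>\<bar>h 0\<bar>\<^sup>2\<close> plus the integral of \<open>\<bar>h'\<bar>\<^sup>2\<close>, uniformly in the radius of the disc of
  integration and, for a point mass \<open>\<mu>\<close>, in its position. Averaging over the circle then gives the
  inequality for every \<open>\<mu>\<close>, the total mass of \<open>\<mu>\<close> entering as a factor of \<open>\<bar>h 0\<bar>\<^sup>2\<close>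
  (\<open>disc_energy_poincare\<close>).

  For a point mass at \<open>\<zeta>\<close> the weight is \<open>(1 - \<bar>z\<bar>\<^sup>2)\<^sup>n / \<bar>\<zeta> - z\<bar>\<^sup>2\<close>. Dividing \<open>h\<close> and \<open>h'\<close> by \<open>\<zeta> - z\<close> leaves
  the radial weight \<open>(1 - \<bar>z\<bar>\<^sup>2)\<^sup>n\<close>, for which monomials are orthogonal, so both integrals become
  weighted sums of squared Taylor coefficients (\<open>parseval_weighted_disc\<close>). The two coefficient sequences are
  linked by a first-order recurrence, and the inequality becomes a discrete Hardy inequality
  (\<open>discrete_hardy\<close>) for the moments of the weight.

  What remains is the value \<open>f\<^bsup>(n-1)\<^esup>(0)\<close>, that is, a Taylor coefficient of \<open>f\<close>. The hypothesis of the
  second part bounds the constant coefficient by \<open>\<integral> \<bar>f\<bar>\<^sup>2 d\<mu>\<^sub>0\<close>; applying it to iterated backward shifts of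
  \<open>f\<close> bounds every coefficient in the same way (\<open>taylor_coeff_bound\<close>).
\<close>

section \<open>Rotation invariance and radial integration\<close>

text \<open>Uniqueness of Haar measure in miniature. For the unit ball \<open>B\<close>, Fubini and translation invariance
turn \<open>\<integral>\<integral> 1\<^sub>A(T y + x) 1\<^sub>B(y) dx dy\<close> into both \<open>\<lambda>(A) \<lambda>(B)\<close> and \<open>\<lambda>(T\<inverse> A) \<lambda>(B)\<close>; the second
evaluation uses that a ball of radius one is carried by \<open>T\<close> to a ball of radius one.\<close>
lemma lborel_distr_orthogonal:
  fixes T :: "'a::euclidean_space \<Rightarrow> 'a"
  assumes T: "orthogonal_transformation T"
  shows "distr lborel borel T = lborel"
proof (rule measure_eqI)
  fix A assume "A \<in> sets (distr lborel borel T)"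
  then have A [measurable]: "A \<in> sets borel" by simp
  have lin: "linear T" using T by (rule orthogonal_transformation_linear)
  define S where "S = inv T"
  have S: "orthogonal_transformation S"
    unfolding S_def using T by (rule orthogonal_transformation_inv)
  have TS: "T (S x) = x" for x
    unfolding S_def using orthogonal_transformation_surj[OF T] by (simp add: surj_f_inv_f)
  have linS: "linear S" using S by (rule orthogonal_transformation_linear)
  have cont: "continuous_on UNIV T" "continuous_on UNIV S"
    using lin linS by (auto intro: linear_continuous_on linear_conv_bounded_linear[THEN iffD1])
  have mT [measurable]: "T \<in> borel_measurable borel"
    and mS [measurable]: "S \<in> borel_measurable borel"
    using cont by (auto intro: borel_measurable_continuous_onI)
  let ?B = "ball 0 1 :: 'a set"
  have [measurable]: "?B \<in> sets borel" by simp
  let ?I = "indicator :: 'a set \<Rightarrow> 'a \<Rightarrow> ennreal"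
  have transl: "(\<integral>\<^sup>+x. f (c + x) \<partial>lborel) = (\<integral>\<^sup>+x. f x \<partial>lborel)"
    if [measurable]: "f \<in> borel_measurable borel" for f :: "'a \<Rightarrow> ennreal" and c
    by (subst (2) lborel_distr_plus[of c, symmetric], subst nn_integral_distr) auto
  have ball: "emeasure lborel (ball c 1) = emeasure lborel ?B" for c :: 'a
    by (simp add: emeasure_ball)
  have "emeasure lborel A * emeasure lborel ?B
        = (\<integral>\<^sup>+y. (\<integral>\<^sup>+x. ?I A (T y + x) * ?I ?B y \<partial>lborel) \<partial>lborel)"
  proof -
    have "(\<integral>\<^sup>+x. ?I A (T y + x) * ?I ?B y \<partial>lborel) = emeasure lborel A * ?I ?B y" for y
      by (subst nn_integral_multc) (auto simp: transl)
    then have "(\<integral>\<^sup>+y. (\<integral>\<^sup>+x. ?I A (T y + x) * ?I ?B y \<partial>lborel) \<partial>lborel)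
        = (\<integral>\<^sup>+y. emeasure lborel A * ?I ?B y \<partial>lborel)"
      by (intro nn_integral_cong)
    then show ?thesis by (subst (asm) nn_integral_cmult) (auto intro: borel_measurable_indicator)
  qed
  also have "\<dots> = (\<integral>\<^sup>+x. (\<integral>\<^sup>+y. ?I A (T y + x) * ?I ?B y \<partial>lborel) \<partial>lborel)"
    by (rule lborel_pair.Fubini') measurable
  \<comment> \<open>Substitute \<open>y - T\<inverse> x\<close> for \<open>y\<close> in the inner integral.\<close>
  also have "\<dots> = (\<integral>\<^sup>+x. (\<integral>\<^sup>+y. ?I A (T y) * ?I (ball (T y) 1) x \<partial>lborel) \<partial>lborel)"
  proof (rule nn_integral_cong)
    fix x
    have "(\<integral>\<^sup>+y. ?I A (T y + x) * ?I ?B y \<partial>lborel)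
        = (\<integral>\<^sup>+y. ?I A (T (- S x + y) + x) * ?I ?B (- S x + y) \<partial>lborel)"
      by (rule transl[symmetric]) measurable
    also have "\<dots> = (\<integral>\<^sup>+y. ?I A (T y) * ?I (ball (T y) 1) x \<partial>lborel)"
    proof (rule nn_integral_cong)
      fix y
      have "norm (- S x + y) = norm (T (- S x + y))"
        using orthogonal_transformation_norm[OF T] by simp
      also have "T (- S x + y) = T y - x"
        using lin by (simp add: linear_diff TS)
      finally show "?I A (T (- S x + y) + x) * ?I ?B (- S x + y)
          = ?I A (T y) * ?I (ball (T y) 1) x"
        using lin by (simp add: linear_diff TS indicator_def dist_norm norm_minus_commute[of "S x" y])
    qed
    finally show "(\<integral>\<^sup>+y. ?I A (T y + x) * ?I ?B y \<partial>lborel) = \<dots>" .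
  qed
  also have "\<dots> = (\<integral>\<^sup>+y. (\<integral>\<^sup>+x. ?I A (T y) * ?I (ball (T y) 1) x \<partial>lborel) \<partial>lborel)"
    by (rule lborel_pair.Fubini'[symmetric]) (simp add: indicator_def dist_norm, measurable)
  also have "\<dots> = (\<integral>\<^sup>+y. ?I A (T y) * emeasure lborel ?B \<partial>lborel)"
  proof (rule nn_integral_cong)
    fix y
    show "(\<integral>\<^sup>+x. ?I A (T y) * ?I (ball (T y) 1) x \<partial>lborel) = ?I A (T y) * emeasure lborel ?B"
      unfolding ball[of "T y", symmetric]
      by (subst nn_integral_cmult) (auto intro: borel_measurable_indicator)
  qed
  also have "\<dots> = emeasure (distr lborel borel T) A * emeasure lborel ?B"
  proof -
    have "(\<integral>\<^sup>+y. ?I A (T y) \<partial>lborel) = (\<integral>\<^sup>+y. ?I A y \<partial>distr lborel borel T)"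
      by (subst nn_integral_distr) auto
    then show ?thesis by (subst nn_integral_multc) auto
  qed
  finally have *: "emeasure lborel A * emeasure lborel ?B
      = emeasure (distr lborel borel T) A * emeasure lborel ?B" .
  have "emeasure lborel ?B \<noteq> 0" "emeasure lborel ?B \<noteq> top"
    using unit_ball_vol_pos[of "real DIM('a)"] by (auto simp: emeasure_ball simp del: unit_ball_vol_pos)
  then show "emeasure (distr lborel borel T) A = emeasure lborel A"
    using * by (simp add: mult.commute[of _ "emeasure lborel ?B"] ennreal_mult_cancel_left)
qed simp


lemma distr_sq_norm_disc:
  assumes "0 \<le> r"
  shows "distr (restrict_space lborel (ball (0::complex) r)) borel (\<lambda>z. (cmod z)\<^sup>2)
       = density lborel (\<lambda>x. ennreal pi * indicator {0..r\<^sup>2} x)" (is "?L = ?R")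
proof (rule measure_eqI_lessThan)
  have disc: "emeasure lborel (ball (0::complex) s) = ennreal (pi * s\<^sup>2)"
    "emeasure lborel (cball (0::complex) s) = ennreal (pi * s\<^sup>2)" if "0 \<le> s" for s
    using that by (simp_all add: emeasure_ball emeasure_cball unit_ball_vol_numeral mult.commute)
  have meas: "(\<lambda>z. (cmod z)\<^sup>2) \<in> borel_measurable (restrict_space lborel (ball (0::complex) r))"
    by (intro measurable_restrict_space1) measurable
  have L: "emeasure ?L {x<..} = emeasure lborel (ball (0::complex) r - {z. (cmod z)\<^sup>2 \<le> x})" for x
  proof -
    have "(\<lambda>z. (cmod z)\<^sup>2) -` {x<..} \<inter> ball 0 r = ball (0::complex) r - {z. (cmod z)\<^sup>2 \<le> x}"
      by auto
    then show ?thesis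
      using meas by (simp add: emeasure_distr emeasure_restrict_space space_restrict_space)
  qed
  have R: "emeasure ?R {x<..} = ennreal pi * emeasure lborel ({0..r\<^sup>2} \<inter> {x<..})" for x
  proof -
    have "emeasure ?R {x<..} = (\<integral>\<^sup>+t. ennreal pi * indicator ({0..r\<^sup>2} \<inter> {x<..}) t \<partial>lborel)"
      by (subst emeasure_density) (auto simp: indicator_def intro!: nn_integral_cong)
    then show ?thesis by (simp add: nn_integral_cmult)
  qed
  show "emeasure ?L {x<..} = emeasure ?R {x<..}" for x
  proof (cases "x < 0")
    case True
    have "{z. (cmod z)\<^sup>2 \<le> x} = {}" 
      using True by (auto simp: not_le intro: less_le_trans)
    moreover have "{0..r\<^sup>2} \<inter> {x<..} = {0..r\<^sup>2}" using True by auto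
    ultimately show ?thesis
      unfolding L R using assms by (simp add: disc ennreal_mult')
  next
    case False
    have 1: "{z. (cmod z)\<^sup>2 \<le> x} = cball 0 (sqrt x)"
      using False by (auto simp: real_le_rsqrt not_less) (metis norm_ge_zero power_mono real_sqrt_pow2)
    show ?thesis
    proof (cases "x < r\<^sup>2")
      case True
      have sub: "cball (0::complex) (sqrt x) \<subseteq> ball 0 r"
        using True assms by (auto intro!: le_less_trans[of _ "sqrt x" r] real_less_lsqrt)
      have "emeasure lborel (ball (0::complex) r - cball 0 (sqrt x))
          = ennreal (pi * r\<^sup>2) - ennreal (pi * x)"
        using False assms by (subst emeasure_Diff[OF _ _ _ sub]) (auto simp: disc)
      also have "\<dots> = ennreal (pi * (r\<^sup>2 - x))"
        using False by (subst ennreal_minus) (auto simp: algebra_simps)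
      moreover have "{0..r\<^sup>2} \<inter> {x<..} = {x<..r\<^sup>2}" using False by auto
      ultimately show ?thesis
        unfolding L R 1 using True by (simp add: ennreal_mult')
    next
      case F: False
      have "ball (0::complex) r \<subseteq> cball 0 (sqrt x)"
        using real_le_rsqrt[of r x] F by (auto intro: order_trans[of _ r "sqrt x"] simp del: real_sqrt_le_iff')
      then have "ball (0::complex) r - cball 0 (sqrt x) = {}" by auto
      moreover have "{0..r\<^sup>2} \<inter> {x<..} = {}" using F by auto
      ultimately show ?thesis unfolding L R 1 by (simp only: emeasure_empty mult_zero_right)
    qed
  qed
  have "emeasure ?L {x<..} \<le> emeasure lborel (ball (0::complex) r)" for x
    unfolding L by (rule emeasure_mono) auto
  then show "emeasure ?L {x<..} < \<infinity>" for x
    using emeasure_lborel_ball_finite[of "0::complex" r] by (auto intro: le_less_trans)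
qed simp_all

text \<open>Radial functions are integrated through the image of area measure under \<open>z \<mapsto> \<bar>z\<bar>\<^sup>2\<close>, which makes
them one-dimensional integrals with constant density \<open>\<pi>\<close>.\<close>
lemma radial_integral_disc:
  fixes F f :: "real \<Rightarrow> real"
  assumes "0 \<le> r" "\<And>x. (F has_real_derivative f x) (at x)" "continuous_on UNIV f"
  shows "(LINT z:ball (0::complex) r|lborel. f ((cmod z)\<^sup>2)) = pi * (F (r\<^sup>2) - F 0)"
proof -
  have [measurable]: "f \<in> borel_measurable borel"
    using assms(3) by (rule borel_measurable_continuous_onI)
  have meas: "(\<lambda>z. (cmod z)\<^sup>2) \<in> borel_measurable (restrict_space lborel (ball (0::complex) r))"
    by (intro measurable_restrict_space1) measurable
  have "(LINT z:ball (0::complex) r|lborel. f ((cmod z)\<^sup>2))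
      = (LINT z|restrict_space lborel (ball (0::complex) r). f ((cmod z)\<^sup>2))"
    by (simp add: set_lebesgue_integral_def integral_restrict_space)
  also have "\<dots> = (LINT x|distr (restrict_space lborel (ball (0::complex) r)) borel (\<lambda>z. (cmod z)\<^sup>2). f x)"
    using meas by (subst integral_distr) auto
  also have "\<dots> = (LINT x|density lborel (\<lambda>x. ennreal (pi * indicator {0..r\<^sup>2} x)). f x)"
    by (subst distr_sq_norm_disc[OF assms(1)]) (simp add: ennreal_mult' ennreal_indicator)
  also have "\<dots> = (LINT x|lborel. (pi * indicator {0..r\<^sup>2} x) *\<^sub>R f x)"
    by (subst integral_density) auto
  also have "\<dots> = pi * (LINT x|lborel. f x * indicator {0..r\<^sup>2} x)"
    by (subst integral_mult_right_zero[symmetric]) (simp add: mult_ac)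
  also have "(LINT x|lborel. f x * indicator {0..r\<^sup>2} x) = F (r\<^sup>2) - F 0"
    using assms by (intro integral_FTC_Icc_real)
      (auto simp: continuous_on_eq_continuous_at)
  finally show ?thesis .
qed

section \<open>Weighted area measure on a disc\<close>

text \<open>The numerator of the Poisson kernel completes the weight of the Dirichlet integral of order \<open>n\<close>
to \<open>(1 - \<bar>z\<bar>\<^sup>2)\<^sup>n\<close>. Restricting the underlying space to the disc, and not just the density, makes
measurability of a function depend on its values inside the disc only.\<close>
definition weighted_disc :: "nat \<Rightarrow> real \<Rightarrow> complex measure" where
  "weighted_disc n r =
     density (restrict_space lborel (ball 0 r)) (\<lambda>z. ennreal ((1 - (cmod z)\<^sup>2) ^ n))"

lemma space_weighted_disc [simp]: "space (weighted_disc n r) = ball 0 r"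
  by (simp add: weighted_disc_def space_restrict_space)

lemma sets_weighted_disc [simp, measurable_cong]:
  "sets (weighted_disc n r) = sets (restrict_space borel (ball 0 r))"
  by (simp add: weighted_disc_def sets_restrict_space)

lemma measurable_weighted_disc_cong:
  "measurable (weighted_disc n r) N = measurable (restrict_space borel (ball 0 r)) N"
  by (rule measurable_cong_sets) auto

lemma continuous_on_measurable_weighted_disc:
  fixes f :: "complex \<Rightarrow> 'b::topological_space"
  assumes "continuous_on (ball 0 r) f"
  shows "f \<in> borel_measurable (weighted_disc n r)"
  using assms by (simp add: measurable_weighted_disc_cong borel_measurable_continuous_on_restrict)

lemma weight_nonneg: "z \<in> ball (0::complex) r \<Longrightarrow> r \<le> 1 \<Longrightarrow> 0 \<le> (1 - (cmod z)\<^sup>2) ^ n"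
  by (intro zero_le_power) (auto simp: power_le_one)

lemma weight_le_1: "z \<in> ball (0::complex) r \<Longrightarrow> r \<le> 1 \<Longrightarrow> (1 - (cmod z)\<^sup>2) ^ n \<le> 1"
  using weight_nonneg[of z r 1] by (auto intro!: power_le_one)

lemma integral_weighted_disc:
  fixes f :: "complex \<Rightarrow> 'b::{banach, second_countable_topology}"
  assumes "r \<le> 1" and [measurable]: "f \<in> borel_measurable (weighted_disc n r)"
  shows "(LINT z|weighted_disc n r. f z)
       = (LINT z:ball 0 r|lborel. (1 - (cmod z)\<^sup>2) ^ n *\<^sub>R f z)"
proof -
  have f: "f \<in> borel_measurable (restrict_space lborel (ball 0 r))"
    using assms(2) by (simp add: weighted_disc_def)
  have "(LINT z|weighted_disc n r. f z)
      = (LINT z|restrict_space lborel (ball 0 r). (1 - (cmod z)\<^sup>2) ^ n *\<^sub>R f z)"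
    unfolding weighted_disc_def using f assms(1) weight_nonneg
    by (subst integral_density)
      (auto intro!: measurable_restrict_space1 simp: space_restrict_space AE_restrict_space_iff)
  then show ?thesis
    by (simp add: set_lebesgue_integral_def integral_restrict_space)
qed

lemma finite_measure_weighted_disc:
  assumes "r \<le> 1"
  shows "finite_measure (weighted_disc n r)"
proof
  have "emeasure (weighted_disc n r) (ball 0 r)
      = (\<integral>\<^sup>+z. ennreal ((1 - (cmod z)\<^sup>2) ^ n) * indicator (ball 0 r) z \<partial>restrict_space lborel (ball 0 r))"
    unfolding weighted_disc_def
    by (rule emeasure_density)
      (auto intro!: measurable_restrict_space1 simp: sets_restrict_space)
  also have "\<dots> \<le> (\<integral>\<^sup>+z. 1 \<partial>restrict_space lborel (ball (0::complex) r))"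
    using assms weight_le_1[of _ r n]
    by (intro nn_integral_mono)
      (auto simp: space_restrict_space indicator_def)
  also have "\<dots> = emeasure lborel (ball (0::complex) r)"
    by (simp add: space_restrict_space emeasure_restrict_space)
  also have "\<dots> < \<infinity>" by (rule emeasure_lborel_ball_finite)
  finally show "emeasure (weighted_disc n r) (space (weighted_disc n r)) \<noteq> \<infinity>"
    by simp
qed

lemma integrable_weighted_disc_bounded:
  fixes f :: "complex \<Rightarrow> 'b::{banach, second_countable_topology}"
  assumes "r \<le> 1" "f \<in> borel_measurable (weighted_disc n r)"
    and "\<And>z. z \<in> ball 0 r \<Longrightarrow> norm (f z) \<le> B"
  shows "integrable (weighted_disc n r) f"
  by (rule finite_measure.integrable_const_bound[OF finite_measure_weighted_disc[OF assms(1)], of _ B])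
    (use assms in \<open>auto intro!: AE_I2\<close>)

lemma integral_weighted_disc_rotate:
  fixes f :: "complex \<Rightarrow> 'b::{banach, second_countable_topology}"
  assumes "r \<le> 1" and f: "f \<in> borel_measurable (weighted_disc n r)" and \<omega>: "cmod \<omega> = 1"
  shows "(LINT z|weighted_disc n r. f (\<omega> * z)) = (LINT z|weighted_disc n r. f z)"
proof -
  have rot: "orthogonal_transformation ((*) \<omega>)"
    unfolding orthogonal_transformation using \<omega>
    by (auto simp: norm_mult bounded_linear.linear bounded_linear_mult_right)
  define h where "h z = indicator (ball 0 r) z *\<^sub>R ((1 - (cmod z)\<^sup>2) ^ n *\<^sub>R f z)" for z
  have f': "f \<in> borel_measurable (restrict_space borel (ball 0 r))"
    using f by (simp add: measurable_weighted_disc_cong)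
  have h: "h \<in> borel_measurable borel"
  proof -
    have "(\<lambda>z. (1 - (cmod z)\<^sup>2) ^ n *\<^sub>R f z) \<in> borel_measurable (restrict_space borel (ball 0 r))"
    proof (rule borel_measurable_scaleR[OF _ f'])
      show "(\<lambda>z. (1 - (cmod z)\<^sup>2) ^ n) \<in> borel_measurable (restrict_space borel (ball 0 r))"
        by (rule measurable_restrict_space1) measurable
    qed
    then show ?thesis
      unfolding h_def by (subst (asm) borel_measurable_restrict_space_iff) auto
  qed
  have fr: "(\<lambda>z. f (\<omega> * z)) \<in> borel_measurable (weighted_disc n r)"
    unfolding measurable_weighted_disc_cong
  proof (rule measurable_compose[OF _ f'])
    show "(*) \<omega> \<in> restrict_space borel (ball 0 r) \<rightarrow>\<^sub>M restrict_space borel (ball 0 r)"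
      using \<omega> by (intro measurable_restrict_space3) (auto simp: norm_mult)
  qed
  have "(LINT z|weighted_disc n r. f (\<omega> * z)) = (LINT z|lborel. h (\<omega> * z))"
    using integral_weighted_disc[OF assms(1) fr] \<omega>
    by (simp add: set_lebesgue_integral_def h_def norm_mult indicator_def)
  also have "\<dots> = (LINT z|distr lborel borel ((*) \<omega>). h z)"
    using h by (subst integral_distr) auto
  also have "\<dots> = (LINT z|weighted_disc n r. f z)"
    unfolding lborel_distr_orthogonal[OF rot]
    using integral_weighted_disc[OF assms(1) f] by (simp add: set_lebesgue_integral_def h_def)
  finally show ?thesis .
qed

text \<open>Rotating by an angle for which the integrand changes sign shows that the integral is its own
negative.\<close>
lemma integral_monomials_orthogonal:
  assumes "r \<le> 1" "j \<noteq> k"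
  shows "(LINT z|weighted_disc n r. z ^ j * cnj z ^ k) = 0"
proof -
  \<comment> \<open>The difference is taken in the reals, so that both orders of \<open>j\<close> and \<open>k\<close> are covered.\<close>
  define \<theta> where "\<theta> = pi / (real j - real k)"
  have "cis \<theta> ^ j * cnj (cis \<theta>) ^ k = cis (real j * \<theta> - real k * \<theta>)"
    by (simp add: Complex.DeMoivre cis_cnj cis_mult)
  also have "real j * \<theta> - real k * \<theta> = (real j - real k) * \<theta>"
    by (simp add: left_diff_distrib)
  also have "\<dots> = pi"
    using assms(2) by (simp add: \<theta>_def)
  finally have rot: "cis \<theta> ^ j * cnj (cis \<theta>) ^ k = - 1" by simp
  have meas: "(\<lambda>z. z ^ j * cnj z ^ k) \<in> borel_measurable (weighted_disc n r)"
    by (intro continuous_on_measurable_weighted_disc continuous_intros)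
  have "(LINT z|weighted_disc n r. z ^ j * cnj z ^ k)
      = (LINT z|weighted_disc n r. (cis \<theta> * z) ^ j * cnj (cis \<theta> * z) ^ k)"
    by (rule integral_weighted_disc_rotate[OF assms(1) meas norm_cis, symmetric])
  also have "\<dots> = (LINT z|weighted_disc n r. (cis \<theta> ^ j * cnj (cis \<theta>) ^ k) * (z ^ j * cnj z ^ k))"
    by (intro Bochner_Integration.integral_cong) (simp_all only: power_mult_distrib complex_cnj_mult mult_ac)
  also have "\<dots> = - (LINT z|weighted_disc n r. z ^ j * cnj z ^ k)"
    by (simp only: rot mult_minus1 Bochner_Integration.integral_minus)
  finally show ?thesis by simp
qed

definition moment :: "nat \<Rightarrow> real \<Rightarrow> nat \<Rightarrow> real" where
  "moment n r k = (LINT z|weighted_disc n r. (cmod z) ^ (2 * k))"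

lemma norm_sq_polynomial:
  fixes c :: "nat \<Rightarrow> complex"
  assumes "r \<le> 1"
  shows "(LINT z|weighted_disc n r. (cmod (\<Sum>k<N. c k * z ^ k))\<^sup>2)
       = (\<Sum>k<N. (cmod (c k))\<^sup>2 * moment n r k)"
proof -
  have int: "integrable (weighted_disc n r) (\<lambda>z. a * (z ^ j * cnj z ^ k))" for a j k
  proof (rule integrable_weighted_disc_bounded[OF assms, of _ _ "cmod a"])
    show "(\<lambda>z. a * (z ^ j * cnj z ^ k)) \<in> borel_measurable (weighted_disc n r)"
      by (intro continuous_on_measurable_weighted_disc continuous_intros)
    show "cmod (a * (z ^ j * cnj z ^ k)) \<le> cmod a" if "z \<in> ball 0 r" for z
    proof -
      have "cmod z ^ j * cmod z ^ k \<le> 1"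
        using that assms by (intro mult_le_one power_le_one zero_le_power) auto
      then show ?thesis by (simp add: norm_mult norm_power mult_left_le)
    qed
  qed
  have "complex_of_real (LINT z|weighted_disc n r. (cmod (\<Sum>k<N. c k * z ^ k))\<^sup>2)
      = (LINT z|weighted_disc n r. (\<Sum>j<N. \<Sum>k<N. (c j * cnj (c k)) * (z ^ j * cnj z ^ k)))"
    unfolding integral_complex_of_real[symmetric] complex_norm_square
    by (intro Bochner_Integration.integral_cong refl) (simp only: cnj_sum sum_product complex_cnj_mult complex_cnj_power mult_ac)
  also have "\<dots> = (\<Sum>j<N. \<Sum>k<N. (c j * cnj (c k)) * (LINT z|weighted_disc n r. z ^ j * cnj z ^ k))"
    by (simp add: Bochner_Integration.integral_sum int)
  also have "\<dots> = (\<Sum>j<N. \<Sum>k<N. if j = k then (c j * cnj (c j)) * of_real (moment n r j) else 0)"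
  proof (intro sum.cong refl)
    fix j k
    have "(LINT z|weighted_disc n r. z ^ j * cnj z ^ j) = of_real (moment n r j)"
      unfolding moment_def integral_complex_of_real[symmetric]
      by (intro Bochner_Integration.integral_cong refl)
        (simp only: power_mult of_real_power complex_norm_square[symmetric] power_mult_distrib[symmetric])
    then show "(c j * cnj (c k)) * (LINT z|weighted_disc n r. z ^ j * cnj z ^ k)
       = (if j = k then (c j * cnj (c j)) * of_real (moment n r j) else 0)"
      using integral_monomials_orthogonal[OF assms] by auto
  qed
  also have "\<dots> = of_real (\<Sum>k<N. (cmod (c k))\<^sup>2 * moment n r k)"
    by (simp flip: complex_norm_square)
  finally show ?thesis by (simp only: of_real_eq_iff)
qed

text \<open>The partial sums satisfy the identity by orthogonality, and on the smaller disc they are dominated by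
the absolutely convergent series at radius \<open>r\<close>.\<close>
lemma parseval_weighted_disc:
  fixes c :: "nat \<Rightarrow> complex"
  assumes r: "0 < r" "r < 1" and G: "\<And>z. z \<in> ball 0 1 \<Longrightarrow> (\<lambda>k. c k * z ^ k) sums G z"
  shows "(\<lambda>k. (cmod (c k))\<^sup>2 * moment n r k) sums (LINT z|weighted_disc n r. (cmod (G z))\<^sup>2)"
proof -
  have sumr: "summable (\<lambda>k. cmod (c k) * r ^ k)"
  proof -
    obtain s where s: "r < s" "s < 1" using r(2) dense by blast
    have "summable (\<lambda>k. c k * of_real s ^ k)"
      using G[of "of_real s"] s r by (auto simp: sums_iff)
    then have "summable (\<lambda>k. norm (c k * of_real r ^ k))"
      by (rule powser_insidea) (use r s in auto)
    then show ?thesis using r by (simp add: norm_mult norm_power)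
  qed
  define B where "B = (\<Sum>k. cmod (c k) * r ^ k)"
  have bound: "cmod (\<Sum>k<N. c k * z ^ k) \<le> B" if "z \<in> ball 0 r" for z N
  proof -
    have "cmod (\<Sum>k<N. c k * z ^ k) \<le> (\<Sum>k<N. cmod (c k) * r ^ k)"
      using that by (intro sum_norm_le) (auto simp: norm_mult norm_power intro!: mult_left_mono power_mono)
    also have "\<dots> \<le> B" unfolding B_def
      using sumr r by (intro sum_le_suminf) auto
    finally show ?thesis .
  qed
  have lim: "(\<lambda>N. \<Sum>k<N. c k * z ^ k) \<longlonglongrightarrow> G z" if "z \<in> ball 0 r" for z
    using G[of z] that r unfolding sums_def by auto
  have meas: "(\<lambda>z. \<Sum>k<N. c k * z ^ k) \<in> borel_measurable (weighted_disc n r)" for N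
    by (intro continuous_on_measurable_weighted_disc continuous_intros)
  have measG: "G \<in> borel_measurable (weighted_disc n r)"
    by (rule borel_measurable_LIMSEQ_metric[OF meas]) (use lim in auto)
  have "(\<lambda>N. LINT z|weighted_disc n r. (cmod (\<Sum>k<N. c k * z ^ k))\<^sup>2)
      \<longlonglongrightarrow> (LINT z|weighted_disc n r. (cmod (G z))\<^sup>2)"
  proof (rule integral_dominated_convergence)
    show "integrable (weighted_disc n r) (\<lambda>_. B\<^sup>2)"
      by (rule finite_measure.integrable_const, rule finite_measure_weighted_disc) (use r in auto)
    show "AE z in weighted_disc n r. (\<lambda>N. (cmod (\<Sum>k<N. c k * z ^ k))\<^sup>2) \<longlonglongrightarrow> (cmod (G z))\<^sup>2"
      using lim by (intro AE_I2 tendsto_intros) auto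
    show "AE z in weighted_disc n r. norm ((cmod (\<Sum>k<N. c k * z ^ k))\<^sup>2) \<le> B\<^sup>2" for N
      using bound by (intro AE_I2) (auto intro!: power_mono)
  qed (use meas measG in measurable)
  then show ?thesis
    using norm_sq_polynomial[of r n c] r by (simp add: sums_def)
qed

lemma moment_eq_set_integral:
  assumes "r \<le> 1"
  shows "moment n r k = (LINT z:ball 0 r|lborel. (1 - (cmod z)\<^sup>2) ^ n * (cmod z) ^ (2 * k))"
  unfolding moment_def using assms
  by (subst integral_weighted_disc)
    (auto intro!: continuous_on_measurable_weighted_disc continuous_intros)

lemma moment_nonneg: "0 \<le> moment n r k"
  unfolding moment_def by (intro Bochner_Integration.integral_nonneg) auto

lemma integrable_radial_weighted_disc:
  assumes "r \<le> 1"
  shows "integrable (weighted_disc n r) (\<lambda>z. (cmod z) ^ k)"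
  using assms
  by (intro integrable_weighted_disc_bounded[of _ _ _ 1])
    (auto intro!: continuous_on_measurable_weighted_disc continuous_intros power_le_one)

lemma moment_decreasing:
  assumes "r \<le> 1" "j \<le> k"
  shows "moment n r k \<le> moment n r j"
  unfolding moment_def using assms
  by (intro integral_mono integrable_radial_weighted_disc) (auto intro!: power_decreasing)

lemma set_integrable_disc_continuous:
  fixes f :: "complex \<Rightarrow> 'b::{banach, second_countable_topology}"
  assumes "continuous_on (cball 0 r) f"
  shows "set_integrable lborel (ball 0 r) f"
proof -
  have "set_integrable lborel (cball 0 r) f"
    unfolding set_integrable_def using assms
    by (intro borel_integrable_compact) auto
  then show ?thesis by (rule set_integrable_subset) auto
qed

text \<open>The polynomial \<open>F(x) = x\<^bsup>k+1\<^esup> (1 - x)\<^bsup>n+1\<^esup>\<close> vanishes at \<open>0\<close> and is nonnegative on \<open>[0, 1]\<close>, so the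
integral of its derivative over \<open>[0, r\<^sup>2]\<close> is nonnegative. The two terms of that derivative are the
two sides of the claim, the left one with an extra factor \<open>n + 1\<close>.\<close>
lemma disc_integral_shift_bound:
  assumes "0 \<le> r" "r \<le> 1"
  shows "(LINT z:ball (0::complex) r|lborel. (1 - (cmod z)\<^sup>2) ^ n * (cmod z) ^ (2 * (k + 1)))
      \<le> (real k + 1) * moment (Suc n) r k"
proof -
  define f where "f x = (real k + 1) * ((1 - x) ^ Suc n * x ^ k) - (real n + 1) * ((1 - x) ^ n * x ^ (k + 1))"
    for x :: real
  define F where "F x = x ^ (k + 1) * (1 - x) ^ Suc n" for x :: real
  have F: "(F has_real_derivative f x) (at x)" for x
  proof -
    have "((\<lambda>x. x ^ (k + 1)) has_real_derivative (real k + 1) * x ^ k) (at x)"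
      using DERIV_pow[of "Suc k" x] by (simp add: add.commute)
    moreover have "((\<lambda>x. (1 - x) ^ Suc n) has_real_derivative - ((real n + 1) * (1 - x) ^ n)) (at x)"
      by (rule derivative_eq_intros refl | simp)+
    ultimately show ?thesis
      unfolding F_def f_def by (auto dest: DERIV_mult simp: algebra_simps)
  qed
  have cf: "continuous_on UNIV f" unfolding f_def by (intro continuous_intros)
  let ?I = "LINT z:ball (0::complex) r|lborel. (1 - (cmod z)\<^sup>2) ^ n * (cmod z) ^ (2 * (k + 1))"
  have "pi * (F (r\<^sup>2) - F 0) \<ge> 0"
    using weight_nonneg[of "of_real r" 1 "Suc n"] assms
    by (simp add: F_def power_le_one)
  then have "0 \<le> (LINT z:ball (0::complex) r|lborel. f ((cmod z)\<^sup>2))"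
    using radial_integral_disc[OF assms(1) F cf] by simp
  also have "\<dots> = (real k + 1) * moment (Suc n) r k - (real n + 1) * ?I"
    unfolding f_def moment_eq_set_integral[OF assms(2)] power_mult[symmetric]
    by (subst set_integral_diff)
      (auto intro!: set_integrable_disc_continuous continuous_intros simp: power_mult)
  finally have le: "(real n + 1) * ?I \<le> (real k + 1) * moment (Suc n) r k" by simp
  have "0 \<le> ?I"
    unfolding set_lebesgue_integral_def using assms weight_nonneg[of _ r n]
    by (intro Bochner_Integration.integral_nonneg) (auto simp: indicator_def)
  then have "?I \<le> (real n + 1) * ?I" by (simp add: mult_le_cancel_right1)
  with le show ?thesis by linarith
qed

text \<open>Summing the geometric series in \<open>\<bar>z\<bar>\<^sup>2\<close> cancels one factor \<open>1 - \<bar>z\<bar>\<^sup>2\<close> of the weight.\<close>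
lemma sum_moments_le:
  assumes "0 \<le> r" "r < 1"
  shows "(\<Sum>N=j..<K. moment (Suc n) r N)
      \<le> (LINT z:ball (0::complex) r|lborel. (1 - (cmod z)\<^sup>2) ^ n * (cmod z) ^ (2 * j))"
proof -
  have "(\<Sum>N=j..<K. moment (Suc n) r N)
      = (LINT z:ball (0::complex) r|lborel. (\<Sum>N=j..<K. (1 - (cmod z)\<^sup>2) ^ Suc n * (cmod z) ^ (2 * N)))"
  proof -
    have "integrable lborel (\<lambda>z. indicator (ball (0::complex) r) z *\<^sub>R
        ((1 - (cmod z)\<^sup>2) ^ Suc n * (cmod z) ^ (2 * N)))" for N
      unfolding set_integrable_def[symmetric]
      by (intro set_integrable_disc_continuous continuous_intros)
    then show ?thesis
      using assms unfolding set_lebesgue_integral_def scaleR_sum_right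
      by (subst Bochner_Integration.integral_sum)
        (auto simp: moment_eq_set_integral set_lebesgue_integral_def)
  qed
  also have "\<dots> \<le> (LINT z:ball (0::complex) r|lborel. (1 - (cmod z)\<^sup>2) ^ n * (cmod z) ^ (2 * j))"
  proof (rule set_integral_mono)
    fix z :: complex assume z: "z \<in> ball 0 r"
    define x where "x = (cmod z)\<^sup>2"
    have x: "0 \<le> x" "x < 1" using z assms by (auto simp: x_def abs_square_less_1)
    have "(1 - x) * (\<Sum>N=j..<K. x ^ N) \<le> x ^ j"
    proof (cases "j \<le> K")
      case True
      then have "(1 - x) * (\<Sum>N=j..<K. x ^ N) = x ^ j - x ^ K"
      proof (induction K rule: dec_induct)
        case (step N)
        have "(1 - x) * (\<Sum>N=j..<Suc N. x ^ N) = (1 - x) * (\<Sum>N=j..<N. x ^ N) + (1 - x) * x ^ N"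
          using step.hyps by (simp add: distrib_left)
        then show ?case using step.IH by (simp add: left_diff_distrib)
      qed simp
      then show ?thesis using x by simp
    qed (use x in auto)
    then have "(1 - x) ^ n * ((1 - x) * (\<Sum>N=j..<K. x ^ N)) \<le> (1 - x) ^ n * x ^ j"
      using x by (intro mult_left_mono) auto
    moreover have "(cmod z) ^ (2 * N) = x ^ N" for N
      by (simp add: x_def power_mult)
    ultimately show "(\<Sum>N=j..<K. (1 - (cmod z)\<^sup>2) ^ Suc n * (cmod z) ^ (2 * N))
        \<le> (1 - (cmod z)\<^sup>2) ^ n * (cmod z) ^ (2 * j)"
      unfolding x_def[symmetric] by (simp add: sum_distrib_left mult_ac)
  qed (auto intro!: set_integrable_disc_continuous continuous_intros)
  finally show ?thesis .
qed

text \<open>The tail of the moment sequence behind index \<open>k\<close> costs only a factor of order \<open>k\<close>, with constants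
that are uniform in the radius. This is what the Hardy inequality below asks of its weights.\<close>
lemma sum_moments_tail:
  assumes "0 \<le> r" "r < 1"
  shows "(\<Sum>N=Suc k..<K. moment (Suc n) r N) \<le> (real k + 1) * moment (Suc n) r k"
  using sum_moments_le[OF assms, of n "Suc k" K] disc_integral_shift_bound[of r n k] assms by simp

lemma sum_moments_total:
  assumes "0 \<le> r" "r < 1"
  shows "(\<Sum>N<K. moment (Suc n) r N) \<le> pi"
proof -
  have "(\<Sum>N<K. moment (Suc n) r N)
      \<le> (LINT z:ball (0::complex) r|lborel. (1 - (cmod z)\<^sup>2) ^ n * (cmod z) ^ (2 * 0))"
    using sum_moments_le[OF assms, of n 0 K] by (simp add: atLeast0LessThan)
  also have "\<dots> \<le> (LINT z:ball (0::complex) r|lborel. 1)"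
    using assms weight_le_1[of _ r n]
    by (intro set_integral_mono) (auto intro!: set_integrable_disc_continuous continuous_intros)
  also have "\<dots> = pi * r\<^sup>2"
    using radial_integral_disc[of r "\<lambda>x. x" "\<lambda>_. 1"] assms by simp
  also have "\<dots> \<le> pi" using assms by (simp add: power_le_one mult_le_cancel_left1)
  finally show ?thesis .
qed

section \<open>A discrete Hardy inequality\<close>

lemma sum_triangle_swap:
  fixes f :: "nat \<Rightarrow> nat \<Rightarrow> 'a::comm_monoid_add"
  shows "(\<Sum>N<K. \<Sum>k<N. f N k) = (\<Sum>k<K. \<Sum>N=Suc k..<K. f N k)"
proof (induction K)
  case (Suc K)
  have "(\<Sum>N=Suc k..<Suc K. f N k) = (\<Sum>N=Suc k..<K. f N k) + f K k" if "k < K" for k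
    using that by simp
  then show ?case using Suc.IH by (simp add: sum.distrib)
qed simp

lemma sum_telescoping_reciprocals:
  "(\<Sum>k<N. 1 / ((real k + 1) * (real k + 2))) \<le> 1"
proof -
  have "(\<Sum>k<N. 1 / ((real k + 1) * (real k + 2))) = 1 - 1 / (real N + 1)"
  proof (induction N)
    case (Suc N)
    have "1 / ((real N + 1) * (real N + 2)) = 1 / (real N + 1) - 1 / (real N + 2)"
      by (simp add: divide_simps)
    then show ?case using Suc.IH by (simp add: add_ac)
  qed simp
  then show ?thesis by simp
qed

text \<open>Summation by parts of \<open>\<Sum> (t\<^sub>k - t\<^bsub>k-1\<^esub>) / (k + 1)\<close>: the gain is the summable kernel
\<open>1 / ((k + 1) (k + 2))\<close>.\<close>
lemma recurrence_solution:
  fixes s t :: "nat \<Rightarrow> complex"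
  assumes rec: "\<And>N. (of_nat N + 1) * (s (Suc N) - s N) = t N - (if N = 0 then 0 else t (N - 1))"
  shows "s (Suc N) = s 0 + t N / (of_nat N + 1) + (\<Sum>k<N. t k / ((of_nat k + 1) * (of_nat k + 2)))"
proof (induction N)
  case 0
  then show ?case using rec[of 0] by (simp add: algebra_simps)
next
  case (Suc N)
  have ne: "(of_nat N + 1 :: complex) \<noteq> 0" "(of_nat N + 2 :: complex) \<noteq> 0"
    using of_nat_neq_0[of N, where 'a = complex] of_nat_neq_0[of "Suc N", where 'a = complex]
    by (simp_all add: add.commute)
  have "s (Suc (Suc N)) = s (Suc N) + (t (Suc N) - t N) / (of_nat N + 2)"
    using rec[of "Suc N"] ne by (simp add: field_simps)
  also have "(t (Suc N) - t N) / (of_nat N + 2)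
      = t (Suc N) / (of_nat N + 2) - t N / (of_nat N + 1) + t N / ((of_nat N + 1) * (of_nat N + 2))"
    using ne by (simp add: divide_simps) (simp add: algebra_simps)
  finally show ?case using Suc.IH by (simp add: add_ac)
qed

lemma weighted_Cauchy_Schwarz:
  fixes p a :: "'i \<Rightarrow> real"
  assumes "\<And>i. i \<in> I \<Longrightarrow> 0 \<le> p i" "(\<Sum>i\<in>I. p i) \<le> 1"
  shows "(\<Sum>i\<in>I. p i * a i)\<^sup>2 \<le> (\<Sum>i\<in>I. p i * (a i)\<^sup>2)"
proof -
  have "(\<Sum>i\<in>I. p i * a i)\<^sup>2 = (\<Sum>i\<in>I. sqrt (p i) * (sqrt (p i) * a i))\<^sup>2"
    using assms(1) by (intro arg_cong[where f = "\<lambda>x. x\<^sup>2"] sum.cong) (auto simp flip: mult.assoc)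
  also have "\<dots> \<le> (\<Sum>i\<in>I. (sqrt (p i))\<^sup>2) * (\<Sum>i\<in>I. (sqrt (p i) * a i)\<^sup>2)"
    by (rule Cauchy_Schwarz_ineq_sum)
  also have "\<dots> = (\<Sum>i\<in>I. p i) * (\<Sum>i\<in>I. p i * (a i)\<^sup>2)"
    using assms(1) by (intro arg_cong2[where f = "(*)"] sum.cong) (auto simp: power_mult_distrib)
  also have "\<dots> \<le> 1 * (\<Sum>i\<in>I. p i * (a i)\<^sup>2)"
    using assms by (intro mult_right_mono sum_nonneg) auto
  finally show ?thesis by simp
qed

lemma recurrence_bound:
  fixes s t :: "nat \<Rightarrow> complex"
  assumes rec: "\<And>N. (of_nat N + 1) * (s (Suc N) - s N) = t N - (if N = 0 then 0 else t (N - 1))"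
  shows "(cmod (s N))\<^sup>2 \<le> 3 * ((cmod (s 0))\<^sup>2 + (if N = 0 then 0 else (cmod (t (N - 1)))\<^sup>2)
     + (\<Sum>k<N. (cmod (t k))\<^sup>2 / ((real k + 1) * (real k + 2))))"
proof (cases N)
  case (Suc M)
  define S where "S = (\<Sum>k<M. 1 / ((real k + 1) * (real k + 2)) * cmod (t k))"
  have three: "(x + y + z)\<^sup>2 \<le> 3 * (x\<^sup>2 + y\<^sup>2 + z\<^sup>2)" for x y z :: real
    using zero_le_power2[of "x - y"] zero_le_power2[of "y - z"] zero_le_power2[of "x - z"]
    by (simp add: power2_eq_square algebra_simps)
  have nk: "cmod (of_nat k + 1) = real k + 1" "cmod (of_nat k + 2) = real k + 2" for k
    using norm_of_nat[of "k + 1", where 'a = complex] norm_of_nat[of "k + 2", where 'a = complex]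
    by (simp_all add: add.commute)
  have "cmod (s N) \<le> cmod (s 0) + cmod (t M / (of_nat M + 1))
      + cmod (\<Sum>k<M. t k / ((of_nat k + 1) * (of_nat k + 2)))"
    unfolding Suc recurrence_solution[OF rec, of M] by (intro order_trans[OF norm_triangle_ineq] add_right_mono norm_triangle_ineq)
  also have "\<dots> \<le> cmod (s 0) + cmod (t M) + S"
  proof (intro add_mono order_refl)
    show "cmod (t M / (of_nat M + 1)) \<le> cmod (t M)"
      by (simp add: norm_divide nk divide_le_eq mult_le_cancel_left1)
    show "cmod (\<Sum>k<M. t k / ((of_nat k + 1) * (of_nat k + 2))) \<le> S"
      unfolding S_def by (intro sum_norm_le) (simp add: norm_divide norm_mult nk)
  qed
  finally have "(cmod (s N))\<^sup>2 \<le> (cmod (s 0) + cmod (t M) + S)\<^sup>2"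
    by (rule power_mono) simp
  also have "\<dots> \<le> 3 * ((cmod (s 0))\<^sup>2 + (cmod (t M))\<^sup>2 + S\<^sup>2)" by (rule three)
  also have "S\<^sup>2 \<le> (\<Sum>k<M. 1 / ((real k + 1) * (real k + 2)) * (cmod (t k))\<^sup>2)"
    unfolding S_def by (rule weighted_Cauchy_Schwarz) (use sum_telescoping_reciprocals in auto)
  also have "\<dots> \<le> (\<Sum>k<N. (cmod (t k))\<^sup>2 / ((real k + 1) * (real k + 2)))"
    using Suc by simp
  finally show ?thesis using Suc by simp
qed simp

text \<open>By the solved recurrence and Cauchy-Schwarz, \<open>\<bar>s\<^sub>N\<bar>\<^sup>2\<close> is bounded by an initial term, a shifted term
\<open>\<bar>t\<^bsub>N-1\<^esub>\<bar>\<^sup>2\<close> and an average of the \<open>\<bar>t\<^sub>k\<bar>\<^sup>2\<close> with \<open>k < N\<close>. The total mass of \<open>w\<close> controls the first and its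
monotonicity the second. In the third, exchanging the order of summation produces tails of \<open>w\<close>,
whose growth is absorbed by the kernel.\<close>
lemma discrete_hardy:
  fixes s t :: "nat \<Rightarrow> complex" and w :: "nat \<Rightarrow> real"
  assumes rec: "\<And>N. (of_nat N + 1) * (s (Suc N) - s N) = t N - (if N = 0 then 0 else t (N - 1))"
    and w: "\<And>N. 0 \<le> w N" "decseq w" "\<And>K. (\<Sum>N<K. w N) \<le> A"
      "\<And>k K. (\<Sum>N=Suc k..<K. w N) \<le> (real k + 1) * w k"
  shows "(\<Sum>N<K. (cmod (s N))\<^sup>2 * w N) \<le> 3 * A * (cmod (s 0))\<^sup>2 + 6 * (\<Sum>N<K. (cmod (t N))\<^sup>2 * w N)"
proof -
  define T where "T = (\<Sum>N<K. (cmod (t N))\<^sup>2 * w N)"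
  have 1: "(\<Sum>N<K. (cmod (s 0))\<^sup>2 * w N) \<le> A * (cmod (s 0))\<^sup>2"
    unfolding sum_distrib_left[symmetric] using mult_right_mono[OF w(3), of "(cmod (s 0))\<^sup>2" K] by (simp add: mult.commute)
  have 2: "(\<Sum>N<K. (if N = 0 then 0 else (cmod (t (N - 1)))\<^sup>2) * w N) \<le> T"
  proof (cases K)
    case (Suc L)
    have "(\<Sum>N<K. (if N = 0 then 0 else (cmod (t (N - 1)))\<^sup>2) * w N)
        = (\<Sum>N<L. (cmod (t N))\<^sup>2 * w (Suc N))"
      unfolding Suc by (simp add: sum.lessThan_Suc_shift del: sum.lessThan_Suc)
    also have "\<dots> \<le> (\<Sum>N<L. (cmod (t N))\<^sup>2 * w N)"
      using w(2) by (intro sum_mono mult_left_mono) (auto simp: decseq_Suc_iff)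
    also have "\<dots> \<le> T" unfolding T_def Suc using w(1) by simp
    finally show ?thesis .
  qed (simp add: T_def)
  have 3: "(\<Sum>N<K. (\<Sum>k<N. (cmod (t k))\<^sup>2 / ((real k + 1) * (real k + 2))) * w N) \<le> T"
  proof -
    have "(\<Sum>N<K. (\<Sum>k<N. (cmod (t k))\<^sup>2 / ((real k + 1) * (real k + 2))) * w N)
        = (\<Sum>k<K. (cmod (t k))\<^sup>2 / ((real k + 1) * (real k + 2)) * (\<Sum>N=Suc k..<K. w N))"
      unfolding sum_distrib_right sum_triangle_swap sum_distrib_left ..
    also have "\<dots> \<le> (\<Sum>k<K. (cmod (t k))\<^sup>2 / ((real k + 1) * (real k + 2)) * ((real k + 1) * w k))"
      by (intro sum_mono mult_left_mono w) auto
    also have "\<dots> = (\<Sum>k<K. (cmod (t k))\<^sup>2 * w k / (real k + 2))"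
      by (intro sum.cong refl) (simp add: divide_simps)
    also have "\<dots> \<le> T"
      unfolding T_def using w(1)
      by (intro sum_mono) (simp add: divide_le_eq mult_le_cancel_left1 mult_nonneg_nonneg not_less)
    finally show ?thesis .
  qed
  have "(\<Sum>N<K. (cmod (s N))\<^sup>2 * w N) \<le> (\<Sum>N<K. 3 * ((cmod (s 0))\<^sup>2 + (if N = 0 then 0 else (cmod (t (N - 1)))\<^sup>2)
     + (\<Sum>k<N. (cmod (t k))\<^sup>2 / ((real k + 1) * (real k + 2)))) * w N)"
    by (intro sum_mono mult_right_mono recurrence_bound rec w)
  also have "\<dots> = 3 * ((\<Sum>N<K. (cmod (s 0))\<^sup>2 * w N)
      + (\<Sum>N<K. (if N = 0 then 0 else (cmod (t (N - 1)))\<^sup>2) * w N)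
      + (\<Sum>N<K. (\<Sum>k<N. (cmod (t k))\<^sup>2 / ((real k + 1) * (real k + 2))) * w N))"
    unfolding sum.distrib[symmetric] sum_distrib_left
    by (intro sum.cong refl) (simp add: distrib_right mult.assoc)
  finally show ?thesis using 1 2 3 unfolding T_def[symmetric] by simp
qed

section \<open>A weighted Poincare inequality at a boundary point\<close>

text \<open>For \<open>\<bar>\<zeta>\<bar> = 1\<close> the Poisson kernel is \<open>(1 - \<bar>z\<bar>\<^sup>2) / \<bar>\<zeta> - z\<bar>\<^sup>2\<close>; its denominator is absorbed into the analytic
function \<open>h z / (\<zeta> - z)\<close> and its numerator raises the exponent of the weight by one. Thus
\<open>point_energy (n + 1)\<close> carries the Poisson kernel of a unit mass at \<open>\<zeta>\<close> times \<open>(1 - \<bar>z\<bar>\<^sup>2)\<^sup>n\<close>.\<close>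
definition point_energy :: "nat \<Rightarrow> real \<Rightarrow> (complex \<Rightarrow> complex) \<Rightarrow> complex \<Rightarrow> real" where
  "point_energy n r h \<zeta> = (LINT z|weighted_disc n r. (cmod (h z / (\<zeta> - z)))\<^sup>2)"

text \<open>Put \<open>G = h / (\<zeta> - z)\<close> and \<open>K = h' / (\<zeta> - z)\<close>, with Taylor coefficients \<open>g\<^sub>N\<close> and \<open>\<kappa>\<^sub>N\<close>. Up to unimodular
factors these are the partial sums at \<open>\<zeta>\<close> of the Taylor series of \<open>h\<close> and \<open>h'\<close>; comparing
coefficients in \<open>h = (\<zeta> - z) G\<close> and \<open>h' = (\<zeta> - z) K\<close> gives the recurrence of the Hardy inequality for
\<open>s\<^sub>N = \<zeta>\<^bsup>N+1\<^esup> g\<^sub>N\<close> and \<open>t\<^sub>N = \<zeta>\<^bsup>N+2\<^esup> \<kappa>\<^sub>N\<close>. The weights are the moments of the disc, and Parseval's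
identity turns the weighted sums back into energies.\<close>
lemma point_energy_poincare:
  assumes h: "h holomorphic_on ball 0 1" and r: "0 < r" "r < 1" and \<zeta>: "cmod \<zeta> = 1"
  shows "point_energy (Suc n) r h \<zeta> \<le> 3 * pi * (cmod (h 0))\<^sup>2 + 6 * point_energy (Suc n) r (deriv h) \<zeta>"
proof -
  define G K where "G z = h z / (\<zeta> - z)" and "K z = deriv h z / (\<zeta> - z)" for z
  have ne: "\<zeta> - z \<noteq> 0" if "z \<in> ball 0 1" for z using that \<zeta> by auto
  have dh: "deriv h holomorphic_on ball 0 1" using h by (intro holomorphic_deriv) auto
  have holG: "G holomorphic_on ball 0 1" unfolding G_def
    using h ne by (intro holomorphic_intros) auto
  have holK: "K holomorphic_on ball 0 1" unfolding K_def
    using ne by (intro holomorphic_on_divide dh holomorphic_intros) auto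
  have expand: "F has_fps_expansion fps_expansion F 0" if "F holomorphic_on ball 0 1" for F :: "complex \<Rightarrow> complex"
    using that by (intro has_fps_expansion_fps_expansion[of "ball 0 1"]) auto
  have sums: "(\<lambda>k. fps_nth (fps_expansion F 0) k * z ^ k) sums F z"
    if "F holomorphic_on ball 0 1" "z \<in> ball 0 1" for F :: "complex \<Rightarrow> complex" and z
    using holomorphic_power_series[of F 0 1 z] that by (simp add: fps_expansion_def)
  define H g \<kappa> where "H = fps_expansion h 0" and "g = fps_expansion G 0" and "\<kappa> = fps_expansion K 0"
  have prod: "fps_expansion F 0 = (fps_const \<zeta> - fps_X) * fps_expansion F' 0"
    if F: "F holomorphic_on ball 0 1" "F' holomorphic_on ball 0 1"
      and eq: "\<And>z. z \<in> ball 0 1 \<Longrightarrow> F z = (\<zeta> - z) * F' z" for F F' :: "complex \<Rightarrow> complex"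
  proof -
    have "(\<lambda>z. (\<zeta> - z) * F' z) has_fps_expansion (fps_const \<zeta> - fps_X) * fps_expansion F' 0"
      by (intro fps_expansion_intros expand F)
    moreover have "eventually (\<lambda>z. (\<zeta> - z) * F' z = F z) (nhds 0)"
      using eq by (intro eventually_nhds_in_open[of "ball 0 1", THEN eventually_mono]) auto
    ultimately have "F has_fps_expansion (fps_const \<zeta> - fps_X) * fps_expansion F' 0"
      using has_fps_expansion_cong[OF _ refl] by fast
    then show ?thesis by (rule fps_expansion_eqI)
  qed
  have H: "H = (fps_const \<zeta> - fps_X) * g" unfolding H_def g_def
    using h holG ne by (intro prod) (auto simp: G_def)
  have dH: "fps_deriv H = (fps_const \<zeta> - fps_X) * \<kappa>"
  proof -
    have "deriv h has_fps_expansion fps_deriv H"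
      unfolding H_def by (intro fps_expansion_intros expand h)
    then have "fps_deriv H = fps_expansion (deriv h) 0"
      by (rule fps_expansion_eqI[symmetric])
    also have "\<dots> = (fps_const \<zeta> - fps_X) * \<kappa>" unfolding \<kappa>_def
      using dh holK ne by (intro prod) (auto simp: K_def)
    finally show ?thesis .
  qed
  define s t where "s N = \<zeta> ^ Suc N * fps_nth g N" and "t N = \<zeta> ^ Suc (Suc N) * fps_nth \<kappa> N" for N
  have rec: "(of_nat N + 1) * (s (Suc N) - s N) = t N - (if N = 0 then 0 else t (N - 1))" for N
  proof -
    have "fps_nth H (Suc N) = \<zeta> * fps_nth g (Suc N) - fps_nth g N"
      unfolding H by (simp add: left_diff_distrib)
    moreover have "(of_nat N + 1) * fps_nth H (Suc N)
        = \<zeta> * fps_nth \<kappa> N - (if N = 0 then 0 else fps_nth \<kappa> (N - 1))"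
      using arg_cong[OF dH, of "\<lambda>f. fps_nth f N"] by (simp add: left_diff_distrib add.commute)
    ultimately have *: "(of_nat N + 1) * (\<zeta> * fps_nth g (Suc N) - fps_nth g N)
        = \<zeta> * fps_nth \<kappa> N - (if N = 0 then 0 else fps_nth \<kappa> (N - 1))" by simp
    have "(of_nat N + 1) * (s (Suc N) - s N)
        = \<zeta> ^ Suc N * ((of_nat N + 1) * (\<zeta> * fps_nth g (Suc N) - fps_nth g N))"
      by (simp add: s_def algebra_simps)
    also have "\<dots> = t N - (if N = 0 then 0 else t (N - 1))"
      unfolding * by (cases N) (simp_all add: t_def algebra_simps)
    finally show ?thesis .
  qed
  have s0: "s 0 = h 0"
  proof -
    have "s 0 = fps_nth H 0" unfolding H s_def by simp
    then show ?thesis using sums[OF h, of 0] by (simp add: H_def fps_expansion_def)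
  qed
  have ns: "cmod (s N) = cmod (fps_nth g N)" "cmod (t N) = cmod (fps_nth \<kappa> N)" for N
    using \<zeta> by (simp_all add: s_def t_def norm_mult norm_power)
  have "(\<lambda>N. (cmod (s N))\<^sup>2 * moment (Suc n) r N) sums point_energy (Suc n) r h \<zeta>"
    unfolding ns point_energy_def G_def[symmetric] g_def
    using r sums[OF holG] by (intro parseval_weighted_disc)
  moreover have "(\<lambda>N. (cmod (t N))\<^sup>2 * moment (Suc n) r N) sums point_energy (Suc n) r (deriv h) \<zeta>"
    unfolding ns point_energy_def K_def[symmetric] \<kappa>_def
    using r sums[OF holK] by (intro parseval_weighted_disc)
  ultimately have lim:
    "(\<lambda>K. \<Sum>N<K. (cmod (s N))\<^sup>2 * moment (Suc n) r N) \<longlonglongrightarrow> point_energy (Suc n) r h \<zeta>"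
    "(\<lambda>K. 3 * pi * (cmod (h 0))\<^sup>2 + 6 * (\<Sum>N<K. (cmod (t N))\<^sup>2 * moment (Suc n) r N))
      \<longlonglongrightarrow> 3 * pi * (cmod (h 0))\<^sup>2 + 6 * point_energy (Suc n) r (deriv h) \<zeta>"
    unfolding sums_def by (auto intro!: tendsto_intros)
  show ?thesis
  proof (rule LIMSEQ_le[OF lim], intro exI allI impI)
    fix K
    show "(\<Sum>N<K. (cmod (s N))\<^sup>2 * moment (Suc n) r N)
        \<le> 3 * pi * (cmod (h 0))\<^sup>2 + 6 * (\<Sum>N<K. (cmod (t N))\<^sup>2 * moment (Suc n) r N)"
      unfolding s0[symmetric] using r
      by (intro discrete_hardy rec moment_nonneg sum_moments_total sum_moments_tail)
        (auto simp: decseq_def moment_decreasing)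
  qed
qed

section \<open>Functions smooth up to the boundary\<close>

text \<open>The constant \<open>c\<close> allows the two uses \<open>f = M_z g\<close> and \<open>f z = f 0 + z g z\<close>, where \<open>g\<close> is the backward
shift of \<open>f\<close>.\<close>
lemma higher_deriv_const_plus_mult:
  assumes g: "g holomorphic_on ball 0 1" and eq: "\<And>z. z \<in> ball 0 1 \<Longrightarrow> f z = c + z * g z"
    and z: "z \<in> ball (0::complex) 1"
  shows "(deriv ^^ Suc n) f z = z * (deriv ^^ Suc n) g z + of_nat (Suc n) * (deriv ^^ n) g z"
  using z
proof (induction n arbitrary: z)
  case 0
  have "((\<lambda>z. c + z * g z) has_field_derivative (z * deriv g z + g z)) (at z)"
    using holomorphic_derivI[OF g _ 0]
    by (auto intro!: derivative_eq_intros)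
  then have "(f has_field_derivative (z * deriv g z + g z)) (at z)"
    by (rule has_field_derivative_transform_within_open[of _ _ _ "ball 0 1"]) (use 0 eq in auto)
  then show ?case by (simp add: DERIV_imp_deriv)
next
  case (Suc n)
  have hol: "(deriv ^^ k) g holomorphic_on ball 0 1" for k
    using g by (intro holomorphic_higher_deriv) auto
  have "((\<lambda>z. z * (deriv ^^ Suc n) g z + of_nat (Suc n) * (deriv ^^ n) g z) has_field_derivative
      (z * deriv ((deriv ^^ Suc n) g) z + (deriv ^^ Suc n) g z + of_nat (Suc n) * deriv ((deriv ^^ n) g) z)) (at z)"
    using holomorphic_derivI[OF hol _ Suc.prems, of "Suc n"] holomorphic_derivI[OF hol _ Suc.prems, of n]
    by (auto intro!: derivative_eq_intros)
  then have "((deriv ^^ Suc n) f has_field_derivative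
      (z * deriv ((deriv ^^ Suc n) g) z + (deriv ^^ Suc n) g z + of_nat (Suc n) * deriv ((deriv ^^ n) g) z)) (at z)"
    by (rule has_field_derivative_transform_within_open[of _ _ _ "ball 0 1"])
      (use Suc.prems Suc.IH in auto)
  then show ?case by (simp add: DERIV_imp_deriv algebra_simps)
qed

lemma D_a_holomorphic: "f \<in> D_a \<Longrightarrow> (deriv ^^ n) f holomorphic_on ball 0 1"
  by (intro holomorphic_higher_deriv) (auto simp: D_a_def)

lemma D_a_bounded:
  assumes "f \<in> D_a"
  shows "\<exists>B. \<forall>z\<in>ball 0 1. cmod ((deriv ^^ n) f z) \<le> B"
proof -
  obtain g where g: "continuous_on (cball 0 1) g" "\<And>z. z \<in> ball 0 1 \<Longrightarrow> g z = (deriv ^^ n) f z"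
    using assms unfolding D_a_def by blast
  have "bounded (g ` cball 0 1)"
    using g(1) by (intro compact_imp_bounded compact_continuous_image) auto
  then obtain B where "\<And>z. z \<in> cball 0 1 \<Longrightarrow> cmod (g z) \<le> B"
    unfolding bounded_iff by blast
  then have "cmod ((deriv ^^ n) f z) \<le> B" if "z \<in> ball 0 1" for z
    using g(2)[OF that] that by (metis ball_subset_cball subsetD)
  then show ?thesis by blast
qed

lemma M_z_D_a:
  assumes f: "f \<in> D_a"
  shows "M_z f \<in> D_a"
proof -
  have hol: "f holomorphic_on ball 0 1" and cont: "continuous_on (cball 0 1) f"
    using f by (auto simp: D_a_def)
  have "\<exists>g. continuous_on (cball 0 1) g \<and> (\<forall>z\<in>ball 0 1. g z = (deriv ^^ n) (M_z f) z)" for n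
  proof (cases n)
    case 0
    then show ?thesis using cont by (intro exI[of _ "M_z f"]) (auto simp: M_z_def intro!: continuous_intros)
  next
    case (Suc k)
    obtain g1 where g1: "continuous_on (cball 0 1) g1" "\<forall>z\<in>ball 0 1. g1 z = (deriv ^^ Suc k) f z"
      using f unfolding D_a_def by blast
    obtain g0 where g0: "continuous_on (cball 0 1) g0" "\<forall>z\<in>ball 0 1. g0 z = (deriv ^^ k) f z"
      using f unfolding D_a_def by blast
    show ?thesis
    proof (intro exI[of _ "\<lambda>z. z * g1 z + of_nat (Suc k) * g0 z"] conjI ballI)
      show "continuous_on (cball 0 1) (\<lambda>z. z * g1 z + of_nat (Suc k) * g0 z)"
        by (intro continuous_intros g0 g1)
      show "z * g1 z + of_nat (Suc k) * g0 z = (deriv ^^ n) (M_z f) z" if "z \<in> ball 0 1" for z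
        unfolding Suc using that g0(2) g1(2) 
        by (subst higher_deriv_const_plus_mult[OF hol, of _ 0]) (auto simp: M_z_def)
    qed
  qed
  then show ?thesis
    unfolding D_a_def using cont hol
    by (auto simp: M_z_def intro!: continuous_intros holomorphic_intros)
qed

definition backward_shift :: "(complex \<Rightarrow> complex) \<Rightarrow> complex \<Rightarrow> complex" where
  "backward_shift f z = (if z = 0 then deriv f 0 else (f z - f 0) / z)"

lemma backward_shift_eq: "f z = f 0 + z * backward_shift f z"
  by (simp add: backward_shift_def)

lemma holomorphic_backward_shift:
  "f holomorphic_on ball 0 1 \<Longrightarrow> backward_shift f holomorphic_on ball 0 1"
  using pole_lemma[of f "ball 0 1" 0] by (simp add: backward_shift_def[abs_def] cong: if_cong)

lemma continuous_on_cball_patch: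
  fixes F :: "complex \<Rightarrow> complex"
  assumes "continuous_on (ball 0 1) F" "continuous_on (cball 0 1 - {0}) F"
  shows "continuous_on (cball 0 1) F"
  unfolding continuous_on_eq_continuous_within
proof
  fix x :: complex assume x: "x \<in> cball 0 1"
  show "continuous (at x within cball 0 1) F"
  proof (cases "x = 0")
    case True
    then have "continuous (at x) F"
      using assms(1) by (simp add: continuous_on_eq_continuous_at)
    then show ?thesis by (rule continuous_at_imp_continuous_at_within)
  next
    case False
    have "at x within cball 0 1 = at x within (cball 0 1 - {0})"
      by (rule at_within_nhd[of _ "- {0}"]) (use False in auto)
    then show ?thesis
      using assms(2) x False by (simp add: continuous_on_eq_continuous_within)
  qed
qed

text \<open>Near the boundary one may divide by \<open>z\<close>: the identity
\<open>f\<^bsup>(n+1)\<^esup> = z g\<^bsup>(n+1)\<^esup> + (n + 1) g\<^bsup>(n)\<^esup>\<close> for \<open>g = backward_shift f\<close> yields the continuous extension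
of each derivative of \<open>g\<close> from those of \<open>f\<close> and of the previous derivative of \<open>g\<close>.\<close>
lemma backward_shift_D_a:
  assumes f: "f \<in> D_a"
  shows "backward_shift f \<in> D_a"
proof -
  let ?g = "backward_shift f"
  have hol: "?g holomorphic_on ball 0 1"
    using f by (intro holomorphic_backward_shift) (auto simp: D_a_def)
  have holn: "(deriv ^^ n) ?g holomorphic_on ball 0 1" for n
    using hol by (intro holomorphic_higher_deriv) auto
  have "continuous_on (cball 0 1) f" using f by (auto simp: D_a_def)
  then have "continuous_on (cball 0 1 - {0}) (\<lambda>z. (f z - f 0) / z)"
    by (intro continuous_intros) (auto elim: continuous_on_subset)
  then have "continuous_on (cball 0 1 - {0}) ?g"
    by (rule continuous_on_eq) (auto simp: backward_shift_def)
  then have cont: "continuous_on (cball 0 1) ?g"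
    by (intro continuous_on_cball_patch holomorphic_on_imp_continuous_on[OF hol])
  have "\<exists>G. continuous_on (cball 0 1) G \<and> (\<forall>z\<in>ball 0 1. G z = (deriv ^^ n) ?g z)" for n
  proof (induction n)
    case 0
    show ?case using cont by (intro exI[of _ ?g]) auto
  next
    case (Suc n)
    then obtain G where G: "continuous_on (cball 0 1) G" "\<And>z. z \<in> ball 0 1 \<Longrightarrow> G z = (deriv ^^ n) ?g z"
      by blast
    obtain F where F: "continuous_on (cball 0 1) F" "\<And>z. z \<in> ball 0 1 \<Longrightarrow> F z = (deriv ^^ Suc n) f z"
      using f unfolding D_a_def by blast
    define G' where "G' z = (if z = 0 then (deriv ^^ Suc n) ?g 0 else (F z - of_nat (Suc n) * G z) / z)" for z
    have G': "G' z = (deriv ^^ Suc n) ?g z" if "z \<in> ball 0 1" for z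
      unfolding G'_def using that F(2) G(2) higher_deriv_const_plus_mult[OF hol backward_shift_eq that, of n]
      by simp
    have "continuous_on (cball 0 1 - {0}) (\<lambda>z. (F z - of_nat (Suc n) * G z) / z)"
      using F(1) G(1) by (intro continuous_intros) (auto elim: continuous_on_subset)
    then have "continuous_on (cball 0 1 - {0}) G'"
      by (rule continuous_on_eq) (auto simp: G'_def)
    moreover have "continuous_on (ball 0 1) G'"
      by (rule continuous_on_eq[OF holomorphic_on_imp_continuous_on[OF holn[of "Suc n"]]])
        (use G' in auto)
    ultimately have "continuous_on (cball 0 1) G'"
      by (intro continuous_on_cball_patch)
    then show ?case using G' by blast
  qed
  then show ?thesis using cont hol by (auto simp: D_a_def)
qed

lemma taylor_coeff_deriv: "taylor_coeff f n = (deriv ^^ n) f 0 / fact n"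
  by (simp add: taylor_coeff_def fps_expansion_def)

lemma taylor_coeff_backward_shift:
  assumes "f \<in> D_a"
  shows "taylor_coeff (backward_shift f) k = taylor_coeff f (Suc k)"
proof -
  have "backward_shift f holomorphic_on ball 0 1"
    using assms by (intro holomorphic_backward_shift) (auto simp: D_a_def)
  then have "(deriv ^^ Suc k) f 0 = of_nat (Suc k) * (deriv ^^ k) (backward_shift f) 0"
    by (subst higher_deriv_const_plus_mult[OF _ backward_shift_eq]) auto
  then show ?thesis
    unfolding taylor_coeff_deriv by (simp add: divide_simps del: funpow.simps of_nat_Suc)
qed

lemma finite_circle_measureD:
  assumes "finite_circle_measure \<mu>"
  shows "finite_measure \<mu>" "sets \<mu> = sets (restrict_space borel (sphere 0 1))" "space \<mu> = sphere 0 1"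
proof -
  show "finite_measure \<mu>" and s: "sets \<mu> = sets (restrict_space borel (sphere 0 1))"
    using assms by (auto simp: finite_circle_measure_def)
  show "space \<mu> = sphere 0 1"
    using sets_eq_imp_space_eq[OF s] by (simp add: space_restrict_space)
qed

lemma integrable_circle_continuous:
  fixes f :: "complex \<Rightarrow> real"
  assumes \<mu>: "finite_circle_measure \<mu>" and f: "continuous_on (sphere 0 1) f"
  shows "integrable \<mu> f"
proof -
  note m = finite_circle_measureD[OF \<mu>]
  have "bounded (f ` sphere 0 1)"
    using f by (intro compact_imp_bounded compact_continuous_image) auto
  then obtain B where "\<And>z. z \<in> sphere 0 1 \<Longrightarrow> norm (f z) \<le> B" unfolding bounded_iff by blast
  moreover have "f \<in> borel_measurable \<mu>"
    using borel_measurable_continuous_on_restrict[OF f] measurable_cong_sets[OF m(2) refl] by blast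
  ultimately show ?thesis
    using m by (intro finite_measure.integrable_const_bound[OF m(1), of _ B] AE_I2) auto
qed

lemma dirichlet_int_0_nonneg: "0 \<le> dirichlet_int \<mu> 0 f"
  by (simp add: dirichlet_int_def)

lemma dirichlet_int_0_M_z:
  assumes "finite_circle_measure \<mu>"
  shows "dirichlet_int \<mu> 0 (M_z f) = dirichlet_int \<mu> 0 f"
  using finite_circle_measureD(3)[OF assms]
  by (auto simp: dirichlet_int_def M_z_def norm_mult intro!: Bochner_Integration.integral_cong)

lemma norm_diff_sq_le: "(cmod (a - b))\<^sup>2 \<le> 2 * (cmod a)\<^sup>2 + 2 * (cmod b)\<^sup>2"
proof -
  have "(cmod (a - b))\<^sup>2 \<le> (cmod a + cmod b)\<^sup>2" by (intro power_mono norm_triangle_ineq4) auto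
  also have "\<dots> \<le> 2 * (cmod a)\<^sup>2 + 2 * (cmod b)\<^sup>2"
    using zero_le_power2[of "cmod a - cmod b"] by (simp add: power2_eq_square algebra_simps)
  finally show ?thesis .
qed

lemma dirichlet_int_0_backward_shift:
  assumes \<mu>: "finite_circle_measure \<mu>" and f: "f \<in> D_a"
  shows "dirichlet_int \<mu> 0 (backward_shift f)
      \<le> 2 * dirichlet_int \<mu> 0 f + 2 * measure \<mu> (space \<mu>) * (cmod (taylor_coeff f 0))\<^sup>2"
proof -
  note m = finite_circle_measureD[OF \<mu>]
  have cont: "continuous_on (sphere 0 1) f"
    using f by (auto simp: D_a_def elim: continuous_on_subset)
  have "dirichlet_int \<mu> 0 (backward_shift f) = (LINT \<zeta>|\<mu>. (cmod (f \<zeta> - f 0))\<^sup>2)"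
    unfolding dirichlet_int_def using m(3)
    by (auto simp: backward_shift_def norm_divide intro!: Bochner_Integration.integral_cong)
  also have "\<dots> \<le> (LINT \<zeta>|\<mu>. 2 * (cmod (f \<zeta>))\<^sup>2 + 2 * (cmod (f 0))\<^sup>2)"
    by (intro integral_mono integrable_circle_continuous[OF \<mu>] continuous_intros cont norm_diff_sq_le)
  also have "\<dots> = 2 * (LINT \<zeta>|\<mu>. (cmod (f \<zeta>))\<^sup>2) + 2 * (cmod (f 0))\<^sup>2 * measure \<mu> (space \<mu>)"
    by (subst Bochner_Integration.integral_add)
      (auto intro!: integrable_circle_continuous[OF \<mu>] continuous_intros cont)
  finally show ?thesis by (simp add: dirichlet_int_def taylor_coeff_deriv mult_ac)
qed

text \<open>Control of the constant term propagates to all coefficients: the backward shift lowers the index by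
one, stays in \<open>D_a\<close>, and is bounded for the \<open>L\<^sup>2\<close> seminorm because \<open>\<bar>\<zeta>\<bar> = 1\<close> and \<open>f 0\<close> is already
controlled.\<close>
lemma taylor_coeff_bound:
  assumes \<mu>: "finite_circle_measure \<mu>"
    and c0: "\<And>f. f \<in> D_a \<Longrightarrow> (cmod (taylor_coeff f 0))\<^sup>2 \<le> c0 * dirichlet_int \<mu> 0 f"
  shows "\<exists>c\<ge>0. \<forall>f\<in>D_a. (cmod (taylor_coeff f k))\<^sup>2 \<le> c * dirichlet_int \<mu> 0 f"
proof (induction k)
  case 0
  have "(cmod (taylor_coeff f 0))\<^sup>2 \<le> \<bar>c0\<bar> * dirichlet_int \<mu> 0 f" if "f \<in> D_a" for f
    by (rule order_trans[OF c0[OF that] mult_right_mono]) (auto simp: dirichlet_int_0_nonneg)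
  then show ?case by (intro exI[of _ "\<bar>c0\<bar>"]) auto
next
  case (Suc k)
  then obtain c where c: "0 \<le> c" "\<And>f. f \<in> D_a \<Longrightarrow> (cmod (taylor_coeff f k))\<^sup>2 \<le> c * dirichlet_int \<mu> 0 f"
    by blast
  define b where "b = 2 + 2 * measure \<mu> (space \<mu>) * \<bar>c0\<bar>"
  have "(cmod (taylor_coeff f (Suc k)))\<^sup>2 \<le> (c * b) * dirichlet_int \<mu> 0 f" if f: "f \<in> D_a" for f
  proof -
    have "(cmod (taylor_coeff f 0))\<^sup>2 \<le> \<bar>c0\<bar> * dirichlet_int \<mu> 0 f"
      by (rule order_trans[OF c0[OF f] mult_right_mono]) (auto simp: dirichlet_int_0_nonneg)
    then have "2 * measure \<mu> (space \<mu>) * (cmod (taylor_coeff f 0))\<^sup>2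
        \<le> 2 * measure \<mu> (space \<mu>) * (\<bar>c0\<bar> * dirichlet_int \<mu> 0 f)"
      by (intro mult_left_mono) auto
    then have "dirichlet_int \<mu> 0 (backward_shift f) \<le> b * dirichlet_int \<mu> 0 f"
      using dirichlet_int_0_backward_shift[OF \<mu> f] by (simp add: b_def algebra_simps)
    then have "c * dirichlet_int \<mu> 0 (backward_shift f) \<le> c * (b * dirichlet_int \<mu> 0 f)"
      using c(1) by (rule mult_left_mono)
    then show ?thesis
      using c(2)[OF backward_shift_D_a[OF f]] taylor_coeff_backward_shift[OF f, of k] by (simp add: mult.assoc)
  qed
  moreover have "0 \<le> c * b" using c(1) by (simp add: b_def)
  ultimately show ?case by blast
qed

section \<open>Energies against a measure on the circle\<close>



lemma bounded_kernel_quotient: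
  assumes h: "continuous_on (ball 0 1) h" and r: "0 < r" "r < 1"
  shows "\<exists>B. \<forall>z\<in>ball 0 r. \<forall>\<zeta>\<in>sphere 0 1. (cmod (h z / (\<zeta> - z)))\<^sup>2 \<le> B"
proof -
  have sub: "cball (0::complex) r \<subseteq> ball 0 1" using r by auto
  have "bounded (h ` cball 0 r)"
    using continuous_on_subset[OF h sub] by (intro compact_imp_bounded compact_continuous_image) auto
  then obtain B where B: "\<And>z. z \<in> cball 0 r \<Longrightarrow> cmod (h z) \<le> B"
    unfolding bounded_iff by blast
  have "(cmod (h z / (\<zeta> - z)))\<^sup>2 \<le> (B / (1 - r))\<^sup>2" if "z \<in> ball 0 r" "\<zeta> \<in> sphere 0 1" for z \<zeta>
  proof (rule power_mono)
    have "1 - r \<le> cmod (\<zeta> - z)" using that norm_triangle_ineq2[of \<zeta> z] by auto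
    moreover have "cmod (h z) \<le> B" using B that by auto
    ultimately show "cmod (h z / (\<zeta> - z)) \<le> B / (1 - r)"
      using r order_trans[OF norm_ge_zero \<open>cmod (h z) \<le> B\<close>]
      by (auto simp: norm_divide intro!: frac_le)
  qed simp
  then show ?thesis by blast
qed

lemma continuous_on_kernel_quotient:
  assumes h: "continuous_on (ball 0 1) h" and r: "r \<le> 1" and \<zeta>: "\<zeta> \<in> sphere 0 1"
  shows "continuous_on (ball 0 r) (\<lambda>z. (cmod (h z / (\<zeta> - z)))\<^sup>2)"
  using r \<zeta> by (intro continuous_intros continuous_on_subset[OF h]) auto

lemma integrable_kernel_quotient:
  assumes h: "continuous_on (ball 0 1) h" and r: "0 < r" "r < 1" and \<zeta>: "\<zeta> \<in> sphere 0 1"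
  shows "integrable (weighted_disc n r) (\<lambda>z. (cmod (h z / (\<zeta> - z)))\<^sup>2)"
proof -
  obtain B where "\<forall>z\<in>ball 0 r. \<forall>\<zeta>\<in>sphere 0 1. (cmod (h z / (\<zeta> - z)))\<^sup>2 \<le> B"
    using bounded_kernel_quotient[OF h r] by blast
  then show ?thesis
    using r \<zeta>
    by (intro integrable_weighted_disc_bounded[of _ _ _ B] continuous_on_measurable_weighted_disc
        continuous_on_kernel_quotient[OF h]) auto
qed

lemma point_energy_nonneg: "0 \<le> point_energy n r h \<zeta>"
  unfolding point_energy_def by (intro Bochner_Integration.integral_nonneg) auto

lemma point_energy_dominated:
  assumes h: "continuous_on (ball 0 1) k" "continuous_on (ball 0 1) f" "continuous_on (ball 0 1) h"
    and r: "0 < r" "r < 1" and \<zeta>: "\<zeta> \<in> sphere 0 1"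
    and le: "\<And>z. z \<in> ball 0 1 \<Longrightarrow> (cmod (k z))\<^sup>2 \<le> a * (cmod (f z))\<^sup>2 + b * (cmod (h z))\<^sup>2"
  shows "point_energy n r k \<zeta> \<le> a * point_energy n r f \<zeta> + b * point_energy n r h \<zeta>"
proof -
  note int = integrable_kernel_quotient[OF _ r \<zeta>]
  have "point_energy n r k \<zeta> \<le>
      (LINT z|weighted_disc n r. a * (cmod (f z / (\<zeta> - z)))\<^sup>2 + b * (cmod (h z / (\<zeta> - z)))\<^sup>2)"
    unfolding point_energy_def
  proof (rule integral_mono)
    fix z assume "z \<in> space (weighted_disc n r)"
    then have "(cmod (k z))\<^sup>2 \<le> a * (cmod (f z))\<^sup>2 + b * (cmod (h z))\<^sup>2"
      using r by (intro le) auto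
    then have "(cmod (k z))\<^sup>2 / (cmod (\<zeta> - z))\<^sup>2
        \<le> (a * (cmod (f z))\<^sup>2 + b * (cmod (h z))\<^sup>2) / (cmod (\<zeta> - z))\<^sup>2"
      by (rule divide_right_mono) auto
    then show "(cmod (k z / (\<zeta> - z)))\<^sup>2
        \<le> a * (cmod (f z / (\<zeta> - z)))\<^sup>2 + b * (cmod (h z / (\<zeta> - z)))\<^sup>2"
      by (simp add: norm_divide power_divide add_divide_distrib)
  qed (use int h in auto)
  also have "\<dots> = a * point_energy n r f \<zeta> + b * point_energy n r h \<zeta>"
    unfolding point_energy_def using int h by simp
  finally show ?thesis .
qed

lemma point_energy_mono_radius:
  assumes h: "continuous_on (ball 0 1) h" and r: "0 < r" "r \<le> r'" "r' < 1" and \<zeta>: "\<zeta> \<in> sphere 0 1"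
  shows "point_energy n r h \<zeta> \<le> point_energy n r' h \<zeta>"
proof -
  let ?F = "\<lambda>z. (1 - (cmod z)\<^sup>2) ^ n *\<^sub>R (cmod (h z / (\<zeta> - z)))\<^sup>2"
  have eq: "point_energy n s h \<zeta> = (LINT z:ball 0 s|lborel. ?F z)" if "s < 1" for s
    unfolding point_energy_def using that \<zeta>
    by (intro integral_weighted_disc continuous_on_measurable_weighted_disc
        continuous_on_kernel_quotient[OF h]) auto
  have int: "set_integrable lborel (ball 0 s) ?F" if "s \<le> r'" for s
    using r that \<zeta>
    by (intro set_integrable_disc_continuous continuous_intros continuous_on_subset[OF h]) auto
  have "(LINT z:ball 0 r|lborel. ?F z) \<le> (LINT z:ball 0 r'|lborel. ?F z)"
    unfolding set_lebesgue_integral_def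
  proof (rule integral_mono)
    show "indicator (ball 0 r) z *\<^sub>R ?F z \<le> indicator (ball 0 r') z *\<^sub>R ?F z" for z
      using weight_nonneg[of z r' n] r by (auto simp: indicator_def)
  qed (use int r in \<open>auto simp: set_integrable_def\<close>)
  then show ?thesis using eq r by auto
qed

definition disc_energy :: "complex measure \<Rightarrow> nat \<Rightarrow> real \<Rightarrow> (complex \<Rightarrow> complex) \<Rightarrow> real" where
  "disc_energy \<mu> n r h =
     (LINT z:ball 0 r|lborel. (cmod (h z))\<^sup>2 * poisson_ext \<mu> z * (1 - (cmod z)\<^sup>2) ^ n)"

lemma integrable_kernel_pair:
  assumes \<mu>: "finite_circle_measure \<mu>"
    and h: "continuous_on (ball 0 1) h" and r: "0 < r" "r < 1"
  shows "integrable (\<mu> \<Otimes>\<^sub>M weighted_disc n r) (\<lambda>(\<zeta>, z). (cmod (h z / (\<zeta> - z)))\<^sup>2)"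
proof -
  note m = finite_circle_measureD[OF \<mu>]
  interpret \<mu>: finite_measure \<mu> by fact
  interpret W: finite_measure "weighted_disc n r"
    using r by (intro finite_measure_weighted_disc) auto
  interpret P: finite_measure "\<mu> \<Otimes>\<^sub>M weighted_disc n r"
    by (rule finite_measure_pair_measure) unfold_locales
  obtain B where B: "\<forall>z\<in>ball 0 r. \<forall>\<zeta>\<in>sphere 0 1. (cmod (h z / (\<zeta> - z)))\<^sup>2 \<le> B"
    using bounded_kernel_quotient[OF h r] by blast
  have [measurable]: "h \<in> borel_measurable (weighted_disc n r)"
    using r by (intro continuous_on_measurable_weighted_disc continuous_on_subset[OF h]) auto
  have [measurable]: "(\<lambda>z. z) \<in> borel_measurable (weighted_disc n r)"
    by (intro continuous_on_measurable_weighted_disc continuous_intros)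
  have [measurable]: "(\<lambda>\<zeta>. \<zeta>) \<in> borel_measurable \<mu>"
    unfolding measurable_cong_sets[OF m(2) refl]
    by (intro borel_measurable_continuous_on_restrict continuous_intros)
  have "(\<lambda>p. (cmod (h (snd p) / (fst p - snd p)))\<^sup>2) \<in> borel_measurable (\<mu> \<Otimes>\<^sub>M weighted_disc n r)"
    by (rule borel_measurable_power borel_measurable_norm borel_measurable_divide borel_measurable_diff
        measurable_compose[OF measurable_snd] measurable_compose[OF measurable_fst])+ measurable
  then show ?thesis
    using B m(3) by (intro P.integrable_const_bound[of _ B] AE_I2)
      (auto simp: space_pair_measure case_prod_beta)
qed

text \<open>Fubini: the Poisson extension is the average over \<open>\<mu>\<close> of the kernels with pole at \<open>\<zeta>\<close>. Every estimate
that is uniform in \<open>\<zeta>\<close> thereby passes to \<open>\<mu>\<close>.\<close>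
lemma disc_energy_eq_point_energy:
  assumes \<mu>: "finite_circle_measure \<mu>"
    and h: "continuous_on (ball 0 1) h" and r: "0 < r" "r < 1"
  shows "disc_energy \<mu> n r h = (LINT \<zeta>|\<mu>. point_energy (Suc n) r h \<zeta>)"
    and "integrable \<mu> (point_energy (Suc n) r h)"
proof -
  note m = finite_circle_measureD[OF \<mu>]
  let ?W = "weighted_disc (Suc n) r"
  interpret \<mu>: finite_measure \<mu> by fact
  interpret W: finite_measure ?W
    using r by (intro finite_measure_weighted_disc) auto
  interpret pair_sigma_finite \<mu> ?W by unfold_locales
  note int = integrable_kernel_pair[OF \<mu> h r, of "Suc n"]
  show "integrable \<mu> (point_energy (Suc n) r h)"
    using integrable_fst[OF int] by (simp add: point_energy_def[abs_def])
  have "(LINT \<zeta>|\<mu>. point_energy (Suc n) r h \<zeta>)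
      = (LINT z|?W. (LINT \<zeta>|\<mu>. (cmod (h z / (\<zeta> - z)))\<^sup>2))"
    unfolding point_energy_def by (rule Fubini_integral[OF int, symmetric])
  also have "\<dots> = (LINT z:ball 0 r|lborel. (1 - (cmod z)\<^sup>2) ^ Suc n *\<^sub>R (LINT \<zeta>|\<mu>. (cmod (h z / (\<zeta> - z)))\<^sup>2))"
    using r integrable_snd[OF int] by (intro integral_weighted_disc) auto
  also have "\<dots> = disc_energy \<mu> n r h"
    unfolding disc_energy_def set_lebesgue_integral_def
  proof (intro Bochner_Integration.integral_cong refl arg_cong2[where f = scaleR])
    fix z
    have "(LINT \<zeta>|\<mu>. (cmod (h z / (\<zeta> - z)))\<^sup>2) = (cmod (h z))\<^sup>2 * (LINT \<zeta>|\<mu>. 1 / (cmod (\<zeta> - z))\<^sup>2)"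
      by (subst integral_mult_right_zero[symmetric]) (simp add: norm_divide power_divide)
    moreover have "poisson_ext \<mu> z = (1 - (cmod z)\<^sup>2) * (LINT \<zeta>|\<mu>. 1 / (cmod (\<zeta> - z))\<^sup>2)"
      unfolding poisson_ext_def by (subst integral_mult_right_zero[symmetric]) simp
    ultimately show "(1 - (cmod z)\<^sup>2) ^ Suc n *\<^sub>R (LINT \<zeta>|\<mu>. (cmod (h z / (\<zeta> - z)))\<^sup>2)
        = (cmod (h z))\<^sup>2 * poisson_ext \<mu> z * (1 - (cmod z)\<^sup>2) ^ n"
      by (simp add: mult_ac)
  qed
  finally show "disc_energy \<mu> n r h = (LINT \<zeta>|\<mu>. point_energy (Suc n) r h \<zeta>)" ..
qed

lemma disc_energy_nonneg:
  assumes "finite_circle_measure \<mu>" "continuous_on (ball 0 1) h" "0 < r" "r < 1"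
  shows "0 \<le> disc_energy \<mu> n r h"
  unfolding disc_energy_eq_point_energy(1)[OF assms]
  by (intro Bochner_Integration.integral_nonneg point_energy_nonneg)

lemma disc_energy_mono_radius:
  assumes \<mu>: "finite_circle_measure \<mu>" and h: "continuous_on (ball 0 1) h"
    and r: "0 < r" "r \<le> r'" "r' < 1"
  shows "disc_energy \<mu> n r h \<le> disc_energy \<mu> n r' h"
  using r finite_circle_measureD(3)[OF \<mu>]
  by (simp add: disc_energy_eq_point_energy[OF \<mu> h])
    (auto intro!: integral_mono disc_energy_eq_point_energy(2)[OF \<mu> h] point_energy_mono_radius[OF h])

lemma disc_energy_dominated:
  assumes \<mu>: "finite_circle_measure \<mu>"
    and h: "continuous_on (ball 0 1) k" "continuous_on (ball 0 1) f" "continuous_on (ball 0 1) h"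
    and r: "0 < r" "r < 1"
    and le: "\<And>z. z \<in> ball 0 1 \<Longrightarrow> (cmod (k z))\<^sup>2 \<le> a * (cmod (f z))\<^sup>2 + b * (cmod (h z))\<^sup>2"
  shows "disc_energy \<mu> n r k \<le> a * disc_energy \<mu> n r f + b * disc_energy \<mu> n r h"
proof -
  note E = disc_energy_eq_point_energy[OF \<mu> _ r]
  have "disc_energy \<mu> n r k
      \<le> (LINT \<zeta>|\<mu>. a * point_energy (Suc n) r f \<zeta> + b * point_energy (Suc n) r h \<zeta>)"
    unfolding E(1)[OF h(1)]
    using finite_circle_measureD(3)[OF \<mu>] point_energy_dominated[OF h r _ le]
    by (intro integral_mono Bochner_Integration.integrable_add integrable_mult_right E(2) h) auto
  also have "\<dots> = a * disc_energy \<mu> n r f + b * disc_energy \<mu> n r h"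
    unfolding E(1)[OF h(2)] E(1)[OF h(3)] using E(2) h by simp
  finally show ?thesis .
qed

lemma disc_energy_poincare:
  assumes \<mu>: "finite_circle_measure \<mu>" and h: "h holomorphic_on ball 0 1" and r: "0 < r" "r < 1"
  shows "disc_energy \<mu> n r h
      \<le> 3 * pi * measure \<mu> (space \<mu>) * (cmod (h 0))\<^sup>2 + 6 * disc_energy \<mu> n r (deriv h)"
proof -
  note E = disc_energy_eq_point_energy[OF \<mu> _ r]
  note m = finite_circle_measureD[OF \<mu>]
  interpret finite_measure \<mu> by fact
  have c: "continuous_on (ball 0 1) h" "continuous_on (ball 0 1) (deriv h)"
    using h holomorphic_deriv[OF h] by (auto intro: holomorphic_on_imp_continuous_on)
  have "disc_energy \<mu> n r h
      \<le> (LINT \<zeta>|\<mu>. 3 * pi * (cmod (h 0))\<^sup>2 + 6 * point_energy (Suc n) r (deriv h) \<zeta>)"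
    unfolding E(1)[OF c(1)] using m(3) point_energy_poincare[OF h r]
    by (intro integral_mono Bochner_Integration.integrable_add integrable_mult_right E(2) c) auto
  also have "\<dots> = 3 * pi * measure \<mu> (space \<mu>) * (cmod (h 0))\<^sup>2 + 6 * disc_energy \<mu> n r (deriv h)"
    unfolding E(1)[OF c(2)] using E(2)[OF c(2)] by (simp add: mult_ac)
  finally show ?thesis .
qed

text \<open>The Poincare inequality for the constant function \<open>1\<close>, whose derivative vanishes, bounds the mass of
the weight \<open>P\<^sub>\<mu> (1 - \<bar>z\<bar>\<^sup>2)\<^sup>n\<close> independently of the radius.\<close>
lemma disc_energy_bounded:
  assumes \<mu>: "finite_circle_measure \<mu>" and h: "continuous_on (ball 0 1) h"
    and B: "\<And>z. z \<in> ball 0 1 \<Longrightarrow> cmod (h z) \<le> B" and r: "0 < r" "r < 1"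
  shows "disc_energy \<mu> n r h \<le> 3 * pi * measure \<mu> (space \<mu>) * B\<^sup>2"
proof -
  have "deriv (\<lambda>_. 1) = (\<lambda>_. 0 :: complex)" by auto
  then have "disc_energy \<mu> n r (\<lambda>_. 1) \<le> 3 * pi * measure \<mu> (space \<mu>)"
    using disc_energy_poincare[OF \<mu> _ r, of "\<lambda>_. 1" n] by (simp add: disc_energy_def)
  then have "B\<^sup>2 * disc_energy \<mu> n r (\<lambda>_. 1) \<le> B\<^sup>2 * (3 * pi * measure \<mu> (space \<mu>))"
    by (rule mult_left_mono) auto
  moreover have "disc_energy \<mu> n r h \<le> B\<^sup>2 * disc_energy \<mu> n r (\<lambda>_. 1) + 0 * disc_energy \<mu> n r (\<lambda>_. 1)"
    using B by (intro disc_energy_dominated[OF \<mu> h _ _ r]) (auto intro!: power_mono)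
  ultimately show ?thesis by (simp add: mult_ac)
qed

text \<open>The energies are nondecreasing and bounded in \<open>r\<close>. This identifies the limit in the definition of the
Dirichlet integral as a genuine one.\<close>
lemma disc_energy_tendsto:
  assumes \<mu>: "finite_circle_measure \<mu>" and h: "continuous_on (ball 0 1) h"
    and B: "\<And>z. z \<in> ball 0 1 \<Longrightarrow> cmod (h z) \<le> B"
  shows "\<exists>L\<ge>0. ((\<lambda>r. disc_energy \<mu> n r h) \<longlongrightarrow> L) (at_left 1)"
proof -
  define S where "S = (\<lambda>r. disc_energy \<mu> n r h) ` {0<..<1}"
  have ne: "S \<noteq> {}" by (auto simp: S_def)
  have bdd: "bdd_above S" unfolding S_def
    using disc_energy_bounded[OF \<mu> h B] by (intro bdd_aboveI2) auto
  have ev: "eventually (\<lambda>r. r \<in> {a<..<1}) (at_left (1::real))" if "a < 1" for a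
    using that by (intro eventually_at_leftI[of a]) auto
  have "((\<lambda>r. disc_energy \<mu> n r h) \<longlongrightarrow> Sup S) (at_left 1)"
  proof (rule increasing_tendsto)
    show "eventually (\<lambda>r. disc_energy \<mu> n r h \<le> Sup S) (at_left 1)"
      by (rule eventually_at_leftI[of 0]) (use bdd in \<open>auto intro!: cSup_upper simp: S_def\<close>)
    fix x assume "x < Sup S"
    then obtain r0 where r0: "0 < r0" "r0 < 1" "x < disc_energy \<mu> n r0 h"
      using less_cSup_iff[OF ne bdd] by (auto simp: S_def)
    show "eventually (\<lambda>r. x < disc_energy \<mu> n r h) (at_left 1)"
      using ev[OF r0(2)]
    proof eventually_elim
      case (elim r)
      then show ?case
        using r0 disc_energy_mono_radius[OF \<mu> h r0(1), of r n] by auto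
    qed
  qed
  moreover have "0 \<le> Sup S"
    using disc_energy_nonneg[OF \<mu> h, of "1/2" n]
    by (intro order_trans[OF _ cSup_upper[OF _ bdd]]) (auto simp: S_def)
  ultimately show ?thesis by blast
qed

section \<open>Dirichlet integrals and allowability\<close>

lemma dirichlet_int_limit:
  assumes \<mu>: "finite_circle_measure \<mu>" and f: "f \<in> D_a"
  shows "0 \<le> dirichlet_int \<mu> (Suc n) f"
    and "((\<lambda>r. 1 / (fact (Suc n) * fact n * pi) * disc_energy \<mu> n r ((deriv ^^ Suc n) f))
            \<longlongrightarrow> dirichlet_int \<mu> (Suc n) f) (at_left 1)"
proof -
  define c :: real where "c = 1 / (fact (Suc n) * fact n * pi)"
  have "0 \<le> c" unfolding c_def by (intro divide_nonneg_nonneg mult_nonneg_nonneg) auto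
  have cont: "continuous_on (ball 0 1) ((deriv ^^ Suc n) f)"
    by (rule holomorphic_on_imp_continuous_on[OF D_a_holomorphic[OF f]])
  obtain B where "\<forall>z\<in>ball 0 1. cmod ((deriv ^^ Suc n) f z) \<le> B"
    using D_a_bounded[OF f] by blast
  then obtain L where L: "0 \<le> L"
    "((\<lambda>r. disc_energy \<mu> n r ((deriv ^^ Suc n) f)) \<longlongrightarrow> L) (at_left 1)"
    using disc_energy_tendsto[OF \<mu> cont] by blast
  have lim: "((\<lambda>r. c * disc_energy \<mu> n r ((deriv ^^ Suc n) f)) \<longlongrightarrow> c * L) (at_left 1)"
    by (intro tendsto_mult_left L)
  have "dirichlet_int \<mu> (Suc n) f = Lim (at_left 1) (\<lambda>r. c * disc_energy \<mu> n r ((deriv ^^ Suc n) f))"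
    by (simp add: dirichlet_int_def disc_energy_def c_def del: funpow.simps fact_Suc)
  also have "\<dots> = c * L" by (rule tendsto_Lim[OF _ lim]) simp
  finally have eq: "dirichlet_int \<mu> (Suc n) f = c * L" .
  show "0 \<le> dirichlet_int \<mu> (Suc n) f" unfolding eq using L(1) \<open>0 \<le> c\<close> by simp
  show "((\<lambda>r. 1 / (fact (Suc n) * fact n * pi) * disc_energy \<mu> n r ((deriv ^^ Suc n) f))
            \<longlongrightarrow> dirichlet_int \<mu> (Suc n) f) (at_left 1)"
    unfolding eq using lim unfolding c_def .
qed

text \<open>From \<open>(z f)\<^bsup>(n+1)\<^esup> = z f\<^bsup>(n+1)\<^esup> + (n + 1) f\<^bsup>(n)\<^esup>\<close>, the first term is dominated by the energy of \<open>f\<close>, and the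
Poincare inequality for \<open>f\<^bsup>(n)\<^esup>\<close> reduces the second one to the same energy and the value of \<open>f\<^bsup>(n)\<^esup>\<close> at
the origin. Since the estimate holds on each disc with constants independent of \<open>r\<close>, it survives the
limit.\<close>
lemma dirichlet_int_M_z_bound:
  assumes \<mu>: "finite_circle_measure \<mu>"
  shows "\<exists>b\<ge>0. \<forall>f\<in>D_a. dirichlet_int \<mu> (Suc n) (M_z f)
     \<le> (2 + 12 * (real (Suc n))\<^sup>2) * dirichlet_int \<mu> (Suc n) f + b * (cmod (taylor_coeff f n))\<^sup>2"
proof -
  define c :: real where "c = 1 / (fact (Suc n) * fact n * pi)"
  define N where "N = real (Suc n)"
  define b where "b = c * (2 * N\<^sup>2 * (3 * pi * measure \<mu> (space \<mu>))) * (fact n)\<^sup>2"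
  have c: "0 \<le> c" unfolding c_def by (intro divide_nonneg_nonneg mult_nonneg_nonneg) auto
  have "dirichlet_int \<mu> (Suc n) (M_z f)
      \<le> (2 + 12 * N\<^sup>2) * dirichlet_int \<mu> (Suc n) f + b * (cmod (taylor_coeff f n))\<^sup>2"
    if f: "f \<in> D_a" for f
  proof -
    let ?E = "\<lambda>r. disc_energy \<mu> n r ((deriv ^^ Suc n) f)"
    let ?h = "(deriv ^^ n) f"
    note cont = holomorphic_on_imp_continuous_on[OF D_a_holomorphic]
    have "f holomorphic_on ball 0 1" using f by (simp add: D_a_def)
    then have deriv: "(deriv ^^ Suc n) (M_z f) z = z * (deriv ^^ Suc n) f z + of_nat (Suc n) * ?h z"
      if "z \<in> ball 0 1" for z
      using that by (intro higher_deriv_const_plus_mult[where c = 0]) (auto simp: M_z_def)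
    have point: "(cmod ((deriv ^^ Suc n) (M_z f) z))\<^sup>2
        \<le> 2 * (cmod ((deriv ^^ Suc n) f z))\<^sup>2 + 2 * N\<^sup>2 * (cmod (?h z))\<^sup>2" if z: "z \<in> ball 0 1" for z
    proof -
      have "(cmod ((deriv ^^ Suc n) (M_z f) z))\<^sup>2
          \<le> 2 * (cmod (z * (deriv ^^ Suc n) f z))\<^sup>2 + 2 * (cmod (- (of_nat (Suc n) * ?h z)))\<^sup>2"
        unfolding deriv[OF z] using norm_diff_sq_le[of "z * (deriv ^^ Suc n) f z" "- (of_nat (Suc n) * ?h z)"]
        by (simp only: diff_minus_eq_add)
      also have "(cmod (- (of_nat (Suc n) * ?h z)))\<^sup>2 = N\<^sup>2 * (cmod (?h z))\<^sup>2"
        unfolding norm_minus_cancel norm_mult norm_of_nat power_mult_distrib N_def ..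
      also have "(cmod (z * (deriv ^^ Suc n) f z))\<^sup>2 \<le> (cmod ((deriv ^^ Suc n) f z))\<^sup>2"
        unfolding norm_mult using z by (intro power_mono mult_left_le_one_le) auto
      finally show ?thesis by simp
    qed
    have bound: "c * disc_energy \<mu> n r ((deriv ^^ Suc n) (M_z f))
        \<le> (2 + 12 * N\<^sup>2) * (c * ?E r) + b * (cmod (taylor_coeff f n))\<^sup>2" if r: "0 < r" "r < 1" for r
    proof -
      have "disc_energy \<mu> n r ((deriv ^^ Suc n) (M_z f))
          \<le> 2 * ?E r + 2 * N\<^sup>2 * disc_energy \<mu> n r ?h"
        by (rule disc_energy_dominated[OF \<mu> _ _ _ r point]) (intro cont f M_z_D_a)+
      also have "disc_energy \<mu> n r ?h
          \<le> 3 * pi * measure \<mu> (space \<mu>) * (cmod (?h 0))\<^sup>2 + 6 * ?E r"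
        using disc_energy_poincare[OF \<mu> D_a_holomorphic[OF f] r, of n n] by simp
      finally have "disc_energy \<mu> n r ((deriv ^^ Suc n) (M_z f))
          \<le> 2 * ?E r + 2 * N\<^sup>2 * (3 * pi * measure \<mu> (space \<mu>) * (cmod (?h 0))\<^sup>2 + 6 * ?E r)"
        by (simp add: mult_left_mono)
      then have "c * disc_energy \<mu> n r ((deriv ^^ Suc n) (M_z f))
          \<le> c * (2 * ?E r + 2 * N\<^sup>2 * (3 * pi * measure \<mu> (space \<mu>) * (cmod (?h 0))\<^sup>2 + 6 * ?E r))"
        using c by (rule mult_left_mono)
      also have "cmod (?h 0) = fact n * cmod (taylor_coeff f n)"
        by (simp add: taylor_coeff_deriv norm_divide)
      finally show ?thesis by (simp add: b_def algebra_simps power_mult_distrib)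
    qed
    show ?thesis
    proof (rule tendsto_le[OF trivial_limit_at_left_real])
      show "((\<lambda>r. c * disc_energy \<mu> n r ((deriv ^^ Suc n) (M_z f)))
          \<longlongrightarrow> dirichlet_int \<mu> (Suc n) (M_z f)) (at_left 1)"
        unfolding c_def by (rule dirichlet_int_limit[OF \<mu> M_z_D_a[OF f]])
      show "((\<lambda>r. (2 + 12 * N\<^sup>2) * (c * ?E r) + b * (cmod (taylor_coeff f n))\<^sup>2)
          \<longlongrightarrow> (2 + 12 * N\<^sup>2) * dirichlet_int \<mu> (Suc n) f + b * (cmod (taylor_coeff f n))\<^sup>2) (at_left 1)"
        unfolding c_def by (intro tendsto_intros dirichlet_int_limit[OF \<mu> f])
      show "eventually (\<lambda>r. c * disc_energy \<mu> n r ((deriv ^^ Suc n) (M_z f))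
          \<le> (2 + 12 * N\<^sup>2) * (c * ?E r) + b * (cmod (taylor_coeff f n))\<^sup>2) (at_left 1)"
        by (rule eventually_at_leftI[of 0]) (use bound in auto)
    qed
  qed
  moreover have "0 \<le> b" unfolding b_def using c by (intro mult_nonneg_nonneg) auto
  ultimately show ?thesis unfolding N_def by blast
qed

lemma dirichlet_int_nonneg:
  "finite_circle_measure \<mu> \<Longrightarrow> f \<in> D_a \<Longrightarrow> 0 \<le> dirichlet_int \<mu> n f"
  by (cases n) (auto intro: dirichlet_int_0_nonneg dirichlet_int_limit(1))

lemma allowableI:
  assumes \<mu>: "\<And>n. n < m \<Longrightarrow> finite_circle_measure (\<mu> n)"
    and A: "\<And>n. n < m \<Longrightarrow> \<exists>A\<ge>0. \<forall>f\<in>D_a. dirichlet_int (\<mu> n) n (M_z f) \<le> A * norm_sq m \<mu> f"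
  shows "allowable m \<mu>"
proof -
  obtain A where A: "\<And>n. n < m \<Longrightarrow> 0 \<le> A n"
    "\<And>n f. n < m \<Longrightarrow> f \<in> D_a \<Longrightarrow> dirichlet_int (\<mu> n) n (M_z f) \<le> A n * norm_sq m \<mu> f"
    using A by metis
  define C where "C = sqrt (1 + (\<Sum>n<m. A n))"
  have S: "0 \<le> (\<Sum>n<m. A n)" using A(1) by (intro sum_nonneg) auto
  have nonneg: "0 \<le> norm_sq m \<mu> f" if "f \<in> D_a" for f
    unfolding norm_sq_def using that \<mu> by (intro sum_nonneg dirichlet_int_nonneg) auto
  have "norm_sq m \<mu> (M_z f) \<le> C\<^sup>2 * norm_sq m \<mu> f" if f: "f \<in> D_a" for f
  proof -
    have "norm_sq m \<mu> (M_z f) \<le> (\<Sum>n<m. A n * norm_sq m \<mu> f)"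
      unfolding norm_sq_def[of _ _ "M_z f"] using A(2) f by (intro sum_mono) auto
    also have "\<dots> = (\<Sum>n<m. A n) * norm_sq m \<mu> f" by (simp add: sum_distrib_right)
    also have "\<dots> \<le> C\<^sup>2 * norm_sq m \<mu> f"
      using S nonneg[OF f] by (intro mult_right_mono) (auto simp: C_def)
    finally show ?thesis .
  qed
  moreover have "0 < C" using S by (simp add: C_def)
  ultimately show ?thesis
    unfolding allowable_def using nonneg M_z_D_a by blast
qed

theorem theorem6p8:
  fixes m :: nat and \<mu> :: "nat \<Rightarrow> complex measure"
  assumes "m \<ge> 1"
    and "\<And>n. n < m \<Longrightarrow> finite_circle_measure (\<mu> n)"
    and "emeasure (\<mu> (m - 1)) (space (\<mu> (m - 1))) \<noteq> 0"
  shows "(m = 1 \<longrightarrow> allowable m \<mu>) \<and>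
    (m \<ge> 2 \<and> (\<exists>c0::real. \<forall>f\<in>D_a. (cmod (taylor_coeff f 0))\<^sup>2 \<le> c0 * dirichlet_int (\<mu> 0) 0 f)
       \<longrightarrow> allowable m \<mu>)"
proof -
  note \<mu> = assms(2)
  have le: "dirichlet_int (\<mu> n) n f \<le> norm_sq m \<mu> f" if "n < m" "f \<in> D_a" for n f
    unfolding norm_sq_def using that \<mu> dirichlet_int_nonneg by (intro member_le_sum) auto
  have boundary: "\<exists>A\<ge>0. \<forall>f\<in>D_a. dirichlet_int (\<mu> 0) 0 (M_z f) \<le> A * norm_sq m \<mu> f"
    using assms(1) le[of 0] \<mu>[of 0] by (intro exI[of _ 1]) (auto simp: dirichlet_int_0_M_z)
  show ?thesis
  proof (intro conjI impI)
    assume "m = 1"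
    then show "allowable m \<mu>" using boundary by (intro allowableI \<mu>) auto
  next
    assume "m \<ge> 2 \<and> (\<exists>c0::real. \<forall>f\<in>D_a. (cmod (taylor_coeff f 0))\<^sup>2 \<le> c0 * dirichlet_int (\<mu> 0) 0 f)"
    then obtain c0 where c0: "\<And>f. f \<in> D_a \<Longrightarrow> (cmod (taylor_coeff f 0))\<^sup>2 \<le> c0 * dirichlet_int (\<mu> 0) 0 f"
      by blast
    show "allowable m \<mu>"
    proof (rule allowableI[OF \<mu>])
      fix n assume n: "n < m"
      show "\<exists>A\<ge>0. \<forall>f\<in>D_a. dirichlet_int (\<mu> n) n (M_z f) \<le> A * norm_sq m \<mu> f"
      proof (cases n)
        case 0
        then show ?thesis using boundary by simp
      next
        case (Suc k)
        define a where "a = 2 + 12 * (real (Suc k))\<^sup>2"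
        obtain b where b: "0 \<le> b" "\<And>f. f \<in> D_a \<Longrightarrow> dirichlet_int (\<mu> n) n (M_z f)
            \<le> a * dirichlet_int (\<mu> n) n f + b * (cmod (taylor_coeff f k))\<^sup>2"
          using dirichlet_int_M_z_bound[OF \<mu>[OF n], of k] unfolding a_def Suc by blast
        obtain c where c: "0 \<le> c" "\<And>f. f \<in> D_a \<Longrightarrow> (cmod (taylor_coeff f k))\<^sup>2 \<le> c * dirichlet_int (\<mu> 0) 0 f"
        proof -
          have "0 < m" using n by simp
          then show ?thesis using taylor_coeff_bound[OF \<mu> c0, of k] that by blast
        qed
        have "dirichlet_int (\<mu> n) n (M_z f) \<le> (a + b * c) * norm_sq m \<mu> f" if f: "f \<in> D_a" for f
        proof -
          have "b * (cmod (taylor_coeff f k))\<^sup>2 \<le> b * (c * norm_sq m \<mu> f)"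
            using b(1) c le[of 0 f] f assms(1)
            by (intro mult_left_mono order_trans[OF c(2)[OF f]]) auto
          moreover have "a * dirichlet_int (\<mu> n) n f \<le> a * norm_sq m \<mu> f"
            using le[OF n f] by (intro mult_left_mono) (auto simp: a_def)
          ultimately show ?thesis using b(2)[OF f] by (simp add: algebra_simps)
        qed
        moreover have "0 \<le> a + b * c" using b(1) c(1) by (simp add: a_def)
        ultimately show ?thesis by blast
      qed
    qed
  qed
qed

end
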